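(* Let $\mathfrak g=A_{2n}^{(2)\dagger}$, $n\ge1$, and $1\le r\le n$; put $\mu_r=1$ if $r<n$ and $\mu_n=2$. Regard $V(\mu_r\overline\Lambda_r)\subset B_A(\overline\Lambda_{2n-r}+\overline\Lambda_r)\subset\widehat V^{r,1}=B_A^{2n-r,1}\otimes B_A^{r,1}$. Then $b\in V(\mu_r\overline\Lambda_r)$ if and only if $b\in\widehat V^{r,1}$, $b$ is a tableau, and $b^{\vee*}=\sigma(b)$.
   Context: $A_{2n}^{(2)\dagger}$ is the affine algebra $A_{2n}^{(2)}$ with Dynkin diagram labeled so that removing the vertex $0$ gives $B_n$. A column word is a strictly decreasing word in $[2n]$; $B_A^{r,1}$ is the set of column words of length $r$. $B_A(\overline\Lambda_{2n-r}+\overline\Lambda_r)$ is the set of semistandard tableaux in $[2n]$ with two columns $u,v$ of heights $2n-r$, $r$; such a tableau is identified with its column-reading word $uv$ and with $u\otimes v\in\widehat V^{r,1}$. "$b=u\otimes v$ is a tableau" means that the top-justified columns $u,v$ form a semistandard tableau. $\mathbb P(w)$ is the Schensted tableau of the word $w$ (the unique semistandard tableau Knuth equivalent to $w$; Knuth relations $xzy\sim zxy$ for $x\le y<z$ and $yzx\sim yxz$ for $x<y\le z$). $\sigma:B_A^{2n-r,1}\otimes B_A^{r,1}\to B_A^{r,1}\otimes B_A^{2n-r,1}$ is the local isomorphism: $\sigma(u\otimes v)$ is the unique $v'\otimes u'$ with $\mathbb P(uv)=\mathbb P(v'u')$ (the identity for $r=n$). For a column word $c$, $c^{\vee*}$ is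 the column word with letter set $\{2n+1-i:i\in[2n],\ i\notin c\}$, and $(u\otimes v)^{\vee*}=u^{\vee*}\otimes v^{\vee*}$. Type $A_{2n-1}$ crystal operators: on letters, $f_i^A(i)=i+1$ ($1\le i\le 2n-1$), all other values $\varnothing$ (undefined); on words (tensor products of letters) by the rule $f_i(b_2\otimes b_1)=f_i(b_2)\otimes b_1$ if $\epsilon_i(b_2)\ge\varphi_i(b_1)$, $b_2\otimes f_i(b_1)$ otherwise, and $e_i(b_2\otimes b_1)=e_i(b_2)\otimes b_1$ if $\epsilon_i(b_2)>\varphi_i(b_1)$, $b_2\otimes e_i(b_1)$ otherwise. Virtual $U_q(B_n)$-operators: $e_i=e_{2n-i}^Ae_i^A$, $f_i=f_{2n-i}^Af_i^A$ for $1\le i\le n-1$, $e_n=e_n^A$, $f_n=f_n^A$. $V(\mu_r\overline\Lambda_r)$ is the subset of $B_A(\overline\Lambda_{2n-r}+\overline\Lambda_r)$ generated by the virtual operators $e_i,f_i$, $1\le i\le n$, from the tableau whose $i$-th row consists of letters $i$. *)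

theory Defs
  imports Main
begin

text \<open>
  A letter is a natural number in \<open>{1..2 * n}\<close>, and a word is a list of letters, which stands
  for the tensor product of its letters in the same order. A column is written as the strictly
  decreasing word obtained by reading it from bottom to top. A tensor product \<open>u \<otimes> v\<close> of two
  columns is the pair \<open>(u, v)\<close>, and its word is \<open>u @ v\<close>.
\<close>

type_synonym word = "nat list"

subsection \<open>Columns, tableaux and Knuth equivalence\<close>

definition columns :: "nat \<Rightarrow> nat \<Rightarrow> word set" where
  "columns n r = {c. set c \<subseteq> {1..2 * n} \<and> length c = r \<and> sorted_wrt (>) c}"

definition Vhat :: "nat \<Rightarrow> nat \<Rightarrow> (word \<times> word) set" where
  "Vhat n r = columns n (2 * n - r) \<times> columns n r"

text \<open>
  A tableau is the list of its columns from left to right. As columns are read from bottom to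
  top, the entry of the column \<open>c\<close> in row \<open>i\<close> (counted from 0) is \<open>rev c ! i\<close>.
\<close>

definition semistandard :: "word list \<Rightarrow> bool" where
  "semistandard T \<longleftrightarrow>
     (\<forall>c\<in>set T. c \<noteq> [] \<and> sorted_wrt (>) c) \<and>
     (\<forall>j. Suc j < length T \<longrightarrow>
        length (T ! Suc j) \<le> length (T ! j) \<and>
        (\<forall>i < length (T ! Suc j). rev (T ! j) ! i \<le> rev (T ! Suc j) ! i))"

definition is_tableau :: "word \<times> word \<Rightarrow> bool" where
  "is_tableau b \<longleftrightarrow> semistandard [fst b, snd b]"

inductive knuth_step :: "word \<Rightarrow> word \<Rightarrow> bool" where
  "x \<le> y \<Longrightarrow> y < z \<Longrightarrow> knuth_step (p @ [x, z, y] @ q) (p @ [z, x, y] @ q)"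
| "x < y \<Longrightarrow> y \<le> z \<Longrightarrow> knuth_step (p @ [y, z, x] @ q) (p @ [y, x, z] @ q)"

definition knuth_equiv :: "word \<Rightarrow> word \<Rightarrow> bool" where
  "knuth_equiv = equivclp knuth_step"

definition schensted_tableau :: "word \<Rightarrow> word list" where
  "schensted_tableau w = (THE T. semistandard T \<and> knuth_equiv (concat T) w)"

subsection \<open>The local isomorphism and the involution\<close>

text \<open>
  For \<open>r = n\<close> the pair \<open>(u, v)\<close> is itself such a pair \<open>(v', u')\<close>, so that \<open>local_iso n n\<close> is
  the identity.
\<close>

definition local_iso :: "nat \<Rightarrow> nat \<Rightarrow> word \<times> word \<Rightarrow> word \<times> word" where
  "local_iso n r b =
     (THE b'. b' \<in> columns n r \<times> columns n (2 * n - r) \<and>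
        schensted_tableau (fst b @ snd b) = schensted_tableau (fst b' @ snd b'))"

definition column_vee_star :: "nat \<Rightarrow> word \<Rightarrow> word" where
  "column_vee_star n c =
     rev (sorted_list_of_set {2 * n + 1 - i | i. i \<in> {1..2 * n} \<and> i \<notin> set c})"

definition vee_star :: "nat \<Rightarrow> word \<times> word \<Rightarrow> word \<times> word" where
  "vee_star n b = (column_vee_star n (fst b), column_vee_star n (snd b))"

subsection \<open>Type A crystal operators on words\<close>

definition f_letter :: "nat \<Rightarrow> nat \<Rightarrow> nat option" where
  "f_letter i a = (if a = i then Some (i + 1) else None)"

definition e_letter :: "nat \<Rightarrow> nat \<Rightarrow> nat option" where
  "e_letter i a = (if a = i + 1 then Some i else None)"

definition phi_letter :: "nat \<Rightarrow> nat \<Rightarrow> nat" where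
  "phi_letter i a = (if f_letter i a = None then 0 else 1)"

definition eps_letter :: "nat \<Rightarrow> nat \<Rightarrow> nat" where
  "eps_letter i a = (if e_letter i a = None then 0 else 1)"

text \<open>
  The functions \<open>\<epsilon>\<close> and \<open>\<phi>\<close> are computed by the usual tensor product formulas, where truncated
  subtraction plays the role of \<open>max 0\<close>. The lemmas \<open>eA_string\<close> and \<open>fA_string\<close> below show that
  they count how often \<open>eA\<close> and \<open>fA\<close> can be applied, and the lemmas \<open>eA_append\<close> and \<open>fA_append\<close>
  give the tensor product rule for an arbitrary splitting of a word into two factors.
\<close>

primrec phi :: "nat \<Rightarrow> word \<Rightarrow> nat" where
  "phi i [] = 0"
| "phi i (a # w) = phi_letter i a + (phi i w - eps_letter i a)"

primrec eps :: "nat \<Rightarrow> word \<Rightarrow> nat" where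
  "eps i [] = 0"
| "eps i (a # w) = eps i w + (eps_letter i a - phi i w)"

primrec fA :: "nat \<Rightarrow> word \<Rightarrow> word option" where
  "fA i [] = None"
| "fA i (a # w) =
     (if eps_letter i a \<ge> phi i w then map_option (\<lambda>a'. a' # w) (f_letter i a)
      else map_option (\<lambda>w'. a # w') (fA i w))"

primrec eA :: "nat \<Rightarrow> word \<Rightarrow> word option" where
  "eA i [] = None"
| "eA i (a # w) =
     (if eps_letter i a > phi i w then map_option (\<lambda>a'. a' # w) (e_letter i a)
      else map_option (\<lambda>w'. a # w') (eA i w))"

lemmas letter_defs = f_letter_def e_letter_def phi_letter_def eps_letter_def

lemma phi_append: "phi i (v @ w) = phi i v + (phi i w - eps i v)"
  by (induction v) auto

lemma eps_append: "eps i (v @ w) = eps i w + (eps i v - phi i w)"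
  by (induction v) (auto simp: phi_append)

lemma fA_None_iff: "fA i w = None \<longleftrightarrow> phi i w = 0"
  by (induction w) (auto simp: letter_defs)

lemma eA_None_iff: "eA i w = None \<longleftrightarrow> eps i w = 0"
  by (induction w) (auto simp: letter_defs)

lemma fA_append:
  "fA i (v @ w) =
     (if eps i v \<ge> phi i w then map_option (\<lambda>v'. v' @ w) (fA i v)
      else map_option (\<lambda>w'. v @ w') (fA i w))"
proof (induction v)
  case Nil
  then show ?case using fA_None_iff[of i w] by (cases "fA i w") auto
next
  case (Cons a v)
  then show ?case by (auto simp: phi_append option.map_comp comp_def letter_defs)
qed

lemma eA_append:
  "eA i (v @ w) =
     (if eps i v > phi i w then map_option (\<lambda>v'. v' @ w) (eA i v)
      else map_option (\<lambda>w'. v @ w') (eA i w))"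
proof (induction v)
  case Nil
  then show ?case by (cases "eA i w") auto
next
  case (Cons a v)
  then show ?case by (auto simp: phi_append option.map_comp comp_def letter_defs)
qed

lemma fA_step: "fA i w = Some w' \<Longrightarrow> phi i w = Suc (phi i w') \<and> eps i w' = Suc (eps i w)"
proof (induction w arbitrary: w')
  case (Cons a w)
  then show ?case
    by (fastforce simp: letter_defs split: if_splits)
qed simp

lemma eA_step: "eA i w = Some w' \<Longrightarrow> eps i w = Suc (eps i w') \<and> phi i w' = Suc (phi i w)"
proof (induction w arbitrary: w')
  case (Cons a w)
  then show ?case
    by (fastforce simp: letter_defs split: if_splits)
qed simp

lemma string_bound:
  assumes none: "\<And>w. g w = None \<longleftrightarrow> h w = (0::nat)"
    and step: "\<And>w w'. g w = Some w' \<Longrightarrow> h w = Suc (h w')"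
  shows "((\<lambda>x. Option.bind x g) ^^ k) (Some w) \<noteq> None \<longleftrightarrow> k \<le> h w"
proof (induction k arbitrary: w)
  case (Suc k)
  have stuck: "((\<lambda>x. Option.bind x g) ^^ m) None = None" for m
    by (induction m) auto
  show ?case
  proof (cases "g w")
    case None
    then show ?thesis using none[of w] stuck by (simp add: funpow_Suc_right del: funpow.simps)
  next
    case (Some w')
    then show ?thesis using step[of w w'] Suc[of w'] by (simp add: funpow_Suc_right del: funpow.simps)
  qed
qed simp

lemma fA_string: "((\<lambda>x. Option.bind x (fA i)) ^^ k) (Some w) \<noteq> None \<longleftrightarrow> k \<le> phi i w"
  by (rule string_bound) (auto simp: fA_None_iff dest: fA_step)

lemma eA_string: "((\<lambda>x. Option.bind x (eA i)) ^^ k) (Some w) \<noteq> None \<longleftrightarrow> k \<le> eps i w"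
  by (rule string_bound) (auto simp: eA_None_iff dest: eA_step)

subsection \<open>Virtual type B operators\<close>

definition virtual_e :: "nat \<Rightarrow> nat \<Rightarrow> word \<Rightarrow> word option" where
  "virtual_e n i w = (if i = n then eA n w else Option.bind (eA i w) (eA (2 * n - i)))"

definition virtual_f :: "nat \<Rightarrow> nat \<Rightarrow> word \<Rightarrow> word option" where
  "virtual_f n i w = (if i = n then fA n w else Option.bind (fA i w) (fA (2 * n - i)))"

definition on_pair :: "(word \<Rightarrow> word option) \<Rightarrow> word \<times> word \<Rightarrow> (word \<times> word) option" where
  "on_pair g b =
     map_option (\<lambda>w. (take (length (fst b)) w, drop (length (fst b)) w)) (g (fst b @ snd b))"

text \<open>
  The crystal \<open>V(\<mu>\<^sub>r \<Lambda>\<^sub>r)\<close>. The generator is the tableau with columns \<open>1, \<dots>, 2n - r\<close> and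
  \<open>1, \<dots>, r\<close>, written from bottom to top. The factor \<open>\<mu>\<^sub>r\<close> (1 for \<open>r < n\<close> and 2 for \<open>r = n\<close>) is determined by
  this generator: it makes \<open>\<mu>\<^sub>r \<Lambda>\<^sub>r\<close> its type B weight.
\<close>

inductive_set V :: "nat \<Rightarrow> nat \<Rightarrow> (word \<times> word) set" for n r :: nat where
  generator: "(rev [1..<2 * n - r + 1], rev [1..<r + 1]) \<in> V n r"
| e_closed: "b \<in> V n r \<Longrightarrow> 1 \<le> i \<Longrightarrow> i \<le> n \<Longrightarrow> on_pair (virtual_e n i) b = Some b' \<Longrightarrow> b' \<in> V n r"
| f_closed: "b \<in> V n r \<Longrightarrow> 1 \<le> i \<Longrightarrow> i \<le> n \<Longrightarrow> on_pair (virtual_f n i) b = Some b' \<Longrightarrow> b' \<in> V n r"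

end

theory Submission
  imports Defs "HOL-Library.Multiset"
begin

text \<open>
  Write \<open>c\<^sup>\<or>\<close> for the image of a column or a pair of columns under the involution. For a
  tableau \<open>b = u \<otimes> v\<close> the equation \<open>b\<^sup>\<or> = \<sigma>(b)\<close> says that the words \<open>u v\<close> and
  \<open>u\<^sup>\<or> v\<^sup>\<or>\<close> are Knuth equivalent (\<open>local_iso_eq_iff\<close>); call such a tableau self-dual. In this form
  the condition can be compared with the crystal operators for two reasons. Knuth
  equivalent words have the same \<open>\<epsilon>\<^sub>i\<close> and \<open>\<phi>\<^sub>i\<close>, and the operators carry them to Knuth equivalent
  words (\<open>knuth_equiv_crystal\<close>). The involution turns \<open>e\<^sub>i\<close> into \<open>e\<^sub>j\<close> with \<open>j = 2n - i\<close> on a column, hence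
  on a product of columns (\<open>column_tableau_eA\<close>, \<open>column_tableau_fA\<close>). As the two factors of a
  virtual operator commute and are exchanged by the involution, virtual operators preserve
  self-duality (\<open>self_dual_virtual_step\<close>). The generator is self-dual, because the involution
  merely exchanges its columns and these commute up to Knuth equivalence. So every element of
  \<open>V\<close> is self-dual.

  Conversely, self-duality forces \<open>\<epsilon>\<^sub>i = \<epsilon>\<^sub>j\<close> for \<open>i + j = 2n\<close>. If no virtual \<open>e\<^sub>i\<close> applies to a self-dual
  tableau, then all \<open>\<epsilon>\<^sub>i\<close> vanish (\<open>virtual_highest_weight\<close>), and the only semistandard tableau
  of the given shape with this property is the generator (\<open>highest_tableau\<close>). Every self-dual
  tableau can therefore be raised to the generator by virtual operators \<open>e\<^sub>i\<close>, and the virtual operators \<open>f\<^sub>i\<close> lead back.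

  The translation of \<open>\<sigma>\<close> rests on three facts: a Knuth class contains at most one
  semistandard tableau (\<open>tableau_unique\<close>), it contains one if it contains a product of two columns
  (\<open>two_columns_to_tableau\<close>), and it contains exactly one product \<open>v' u'\<close> of columns of the exchanged
  heights if it contains the tableau \<open>u v\<close> (\<open>tableau_column_swap\<close>, \<open>column_pair_unique\<close>). All of
  them follow from the same principle: the families of words involved are
  stable under the crystal operators, so that it suffices to inspect highest weight words
  (\<open>equiv_transport\<close>, \<open>equiv_unique\<close>), and these can be written down explicitly.
\<close>

section \<open>Knuth equivalence and crystal operators\<close>

abbreviation knuth_infix (infix "\<sim>" 50) where "w \<sim> w' \<equiv> knuth_equiv w w'"

lemma knuth_equiv_refl [simp]: "w \<sim> w"
  by (simp add: knuth_equiv_def)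

lemma knuth_equiv_sym: "w \<sim> w' \<Longrightarrow> w' \<sim> w"
  unfolding knuth_equiv_def by (rule equivclp_sym)

lemma knuth_equiv_trans [trans]: "w \<sim> w' \<Longrightarrow> w' \<sim> w'' \<Longrightarrow> w \<sim> w''"
  unfolding knuth_equiv_def by (rule equivclp_trans)

lemma knuth_step_imp_equiv: "knuth_step w w' \<Longrightarrow> w \<sim> w'"
  unfolding knuth_equiv_def by (rule r_into_equivclp)

lemma knuth_step_context: "knuth_step w w' \<Longrightarrow> knuth_step (p @ w @ q) (p @ w' @ q)"
proof (induction rule: knuth_step.induct)
  case (1 x y z p' q')
  then show ?case using knuth_step.intros(1)[of x y z "p @ p'" "q' @ q"] by simp
next
  case (2 x y z p' q')
  then show ?case using knuth_step.intros(2)[of x y z "p @ p'" "q' @ q"] by simp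
qed

lemma knuth_equiv_context: "w \<sim> w' \<Longrightarrow> p @ w @ q \<sim> p @ w' @ q"
  unfolding knuth_equiv_def
proof (induction rule: equivclp_induct)
  case (step y z)
  then show ?case
    by (meson knuth_step_context equivclp_into_equivclp)
qed simp

lemma knuth_equiv_append_left: "w \<sim> w' \<Longrightarrow> p @ w \<sim> p @ w'"
  using knuth_equiv_context[of w w' p "[]"] by simp

lemma knuth_equiv_append_right: "w \<sim> w' \<Longrightarrow> w @ q \<sim> w' @ q"
  using knuth_equiv_context[of w w' "[]" q] by simp

lemma knuth_step_mset: "knuth_step w w' \<Longrightarrow> mset w = mset w'"
  by (induction rule: knuth_step.induct) simp_all

text \<open>
  In particular Knuth equivalence preserves the set of letters, so bounds on letters pass from a
  word to its whole class.
\<close>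

lemma knuth_equiv_mset: "w \<sim> w' \<Longrightarrow> mset w = mset w'"
  unfolding knuth_equiv_def
proof (induction rule: equivclp_induct)
  case (step y z)
  then show ?case using knuth_step_mset[of y z] knuth_step_mset[of z y] by auto
qed simp

lemma knuth_swap_first: "x \<le> y \<Longrightarrow> y < z \<Longrightarrow> [x, z, y] \<sim> [z, x, y]"
  using knuth_step.intros(1)[of x y z "[]" "[]"] by (simp add: knuth_step_imp_equiv)

lemma knuth_swap_last: "x < y \<Longrightarrow> y \<le> z \<Longrightarrow> [y, z, x] \<sim> [y, x, z]"
  using knuth_step.intros(2)[of x y z "[]" "[]"] by (simp add: knuth_step_imp_equiv)

definition crystal_equiv where
  "crystal_equiv i w w' \<longleftrightarrow> phi i w = phi i w' \<and> eps i w = eps i w' \<and>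
     rel_option knuth_equiv (fA i w) (fA i w') \<and> rel_option knuth_equiv (eA i w) (eA i w')"

text \<open>
  The signature rule sees at most the letters \<open>i\<close> and \<open>i + 1\<close> of the three, so that this is a finite
  check. The images under an operator are again Knuth equivalent, but possibly by the other
  relation: with \<open>z = i + 1\<close>, applying \<open>f\<^sub>i\<close> to \<open>i, i + 1, i\<close> and \<open>i + 1, i, i\<close> turns a relation of the
  first kind into one of the second.
\<close>

lemma crystal_equiv_triples:
  shows "x \<le> y \<Longrightarrow> y < z \<Longrightarrow> crystal_equiv i [x, z, y] [z, x, y]"
    and "x < y \<Longrightarrow> y \<le> z \<Longrightarrow> crystal_equiv i [y, z, x] [y, x, z]"
  unfolding crystal_equiv_def letter_defs
  by (auto simp: letter_defs intro: knuth_swap_first knuth_swap_last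
      knuth_equiv_sym[OF knuth_swap_first] knuth_equiv_sym[OF knuth_swap_last])

text \<open>
  By the tensor product rule the factor on which an operator acts is determined by the values of
  \<open>\<epsilon>\<close> and \<open>\<phi>\<close> on the factors, and these agree for both words.
\<close>

lemma crystal_equiv_context:
  assumes "w \<sim> w'" and "crystal_equiv i w w'"
  shows "crystal_equiv i (p @ w @ q) (p @ w' @ q)"
  using assms unfolding crystal_equiv_def
  by (auto simp: phi_append eps_append fA_append eA_append option.rel_map
      intro: knuth_equiv_append_left knuth_equiv_append_right knuth_equiv_context
        option.rel_refl_strong
      elim!: option.rel_mono_strong)

lemma knuth_step_crystal: "knuth_step w w' \<Longrightarrow> crystal_equiv i w w'"
proof (induction rule: knuth_step.induct)
  case 1
  then show ?case by (intro crystal_equiv_context knuth_swap_first crystal_equiv_triples)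
next
  case 2
  then show ?case by (intro crystal_equiv_context knuth_swap_last crystal_equiv_triples)
qed

lemma rel_option_knuth_equiv:
  shows "symp (rel_option knuth_equiv)" and "transp (rel_option knuth_equiv)"
proof -
  have "symp knuth_equiv" and "transp knuth_equiv"
    by (blast intro: sympI transpI knuth_equiv_sym knuth_equiv_trans)+
  then show "symp (rel_option knuth_equiv)" and "transp (rel_option knuth_equiv)"
    by (simp_all add: option.rel_symp option.rel_transp)
qed

lemma crystal_equiv_sym: "crystal_equiv i w w' \<Longrightarrow> crystal_equiv i w' w"
  by (auto simp: crystal_equiv_def dest: sympD[OF rel_option_knuth_equiv(1)])

lemma crystal_equiv_trans: "crystal_equiv i w w' \<Longrightarrow> crystal_equiv i w' w'' \<Longrightarrow> crystal_equiv i w w''"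
  by (auto simp: crystal_equiv_def dest: transpD[OF rel_option_knuth_equiv(2)])

lemma knuth_equiv_crystal: "w \<sim> w' \<Longrightarrow> crystal_equiv i w w'"
  unfolding knuth_equiv_def
proof (induction rule: equivclp_induct)
  case base
  show ?case by (auto simp: crystal_equiv_def option.rel_refl)
next
  case (step y z)
  then show ?case
    using knuth_step_crystal[of y z i] knuth_step_crystal[of z y i]
    by (blast intro: crystal_equiv_sym crystal_equiv_trans)
qed

lemma knuth_equiv_eps: "w \<sim> w' \<Longrightarrow> eps i w = eps i w'"
  and knuth_equiv_fA: "w \<sim> w' \<Longrightarrow> rel_option knuth_equiv (fA i w) (fA i w')"
  and knuth_equiv_eA: "w \<sim> w' \<Longrightarrow> rel_option knuth_equiv (eA i w) (eA i w')"
  using knuth_equiv_crystal[of w w' i] by (auto simp: crystal_equiv_def)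

section \<open>Reduction to highest weight words\<close>

lemma fA_splits:
  "fA i w = Some w' \<Longrightarrow> \<exists>p q. w = p @ i # q \<and> w' = p @ Suc i # q"
proof (induction w arbitrary: w')
  case (Cons x w)
  show ?case
  proof (cases "eps_letter i x \<ge> phi i w")
    case True
    then show ?thesis using Cons.prems by (auto simp: letter_defs split: if_splits)
  next
    case False
    then obtain v where "fA i w = Some v" and w': "w' = x # v" using Cons.prems by auto
    then obtain p q where "w = p @ i # q \<and> v = p @ Suc i # q" using Cons.IH by blast
    then show ?thesis using w' by (intro exI[of _ "x # p"] exI[of _ q]) simp
  qed
qed simp

lemma eA_splits:
  "eA i w = Some w' \<Longrightarrow> \<exists>p q. w = p @ Suc i # q \<and> w' = p @ i # q"
proof (induction w arbitrary: w')
  case (Cons x w)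
  show ?case
  proof (cases "eps_letter i x > phi i w")
    case True
    then show ?thesis using Cons.prems by (auto simp: letter_defs split: if_splits)
  next
    case False
    then obtain v where "eA i w = Some v" and w': "w' = x # v" using Cons.prems by auto
    then obtain p q where "w = p @ Suc i # q \<and> v = p @ i # q" using Cons.IH by blast
    then show ?thesis using w' by (intro exI[of _ "x # p"] exI[of _ q]) simp
  qed
qed simp

lemma fA_eA:
  assumes "eA i w = Some w'"
  shows "fA i w' = Some w"
  using assms
proof (induction w arbitrary: w')
  case (Cons a w)
  show ?case
  proof (cases "eps_letter i a > phi i w")
    case True
    then show ?thesis using Cons.prems by (auto simp: letter_defs split: if_splits)
  next
    case False
    then obtain v where v: "eA i w = Some v" "w' = a # v" using Cons.prems by auto
    then have "fA i v = Some w" "phi i v = Suc (phi i w)" using Cons.IH eA_step by auto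
    then show ?thesis using v False by simp
  qed
qed simp

lemma eA_fA:
  assumes "fA i w = Some w'"
  shows "eA i w' = Some w"
  using assms
proof (induction w arbitrary: w')
  case (Cons a w)
  show ?case
  proof (cases "eps_letter i a \<ge> phi i w")
    case True
    then show ?thesis using Cons.prems by (auto simp: letter_defs split: if_splits)
  next
    case False
    then obtain v where v: "fA i w = Some v" "w' = a # v" using Cons.prems by auto
    then have "eA i v = Some w" "phi i w = Suc (phi i v)" using Cons.IH fA_step by auto
    then show ?thesis using v False by simp
  qed
qed simp

text \<open>
  Neither \<open>i\<close> nor \<open>i + 1\<close> is visible to the signature rule for \<open>j\<close>.
\<close>

lemma far_phi_eps:
  assumes "Suc i < j \<or> Suc j < i"
  shows "phi j (p @ Suc i # q) = phi j (p @ i # q)" and "eps j (p @ Suc i # q) = eps j (p @ i # q)"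
proof -
  have *: "phi j (Suc i # q) = phi j (i # q)" "eps j (Suc i # q) = eps j (i # q)"
    using assms by (auto simp: letter_defs)
  show "phi j (p @ Suc i # q) = phi j (p @ i # q)" and "eps j (p @ Suc i # q) = eps j (p @ i # q)"
    by (simp_all only: phi_append eps_append *)
qed

text \<open>
  The two operators change different letters, and each leaves the signature of the other unchanged.
\<close>

lemma eA_commute:
  assumes far: "Suc i < j \<or> Suc j < i"
    and i: "eA i w = Some w1" and j: "eA j w = Some w2"
  shows "\<exists>w'. eA j w1 = Some w' \<and> eA i w2 = Some w'"
  using i j
proof (induction w arbitrary: w1 w2)
  case (Cons a w)
  have pres: "phi l v' = phi l v" if "eA k v = Some v'" "Suc k < l \<or> Suc l < k" for k l v v'
    using eA_splits[OF that(1)] far_phi_eps(1)[OF that(2)] by auto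
  consider "eps_letter i a > phi i w" | "eps_letter j a > phi j w"
    | "\<not> eps_letter i a > phi i w" "\<not> eps_letter j a > phi j w"
    by blast
  then show ?case
  proof cases
    case 1
    then show ?thesis using Cons.prems far pres[of j w _ i]
      by (auto simp: letter_defs split: if_splits)
  next
    case 2
    then show ?thesis using Cons.prems far pres[of i w _ j]
      by (auto simp: letter_defs split: if_splits)
  next
    case 3
    then obtain v1 v2 where v: "eA i w = Some v1" "w1 = a # v1" "eA j w = Some v2" "w2 = a # v2"
      using Cons.prems by auto
    moreover from v obtain v' where "eA j v1 = Some v'" "eA i v2 = Some v'" using Cons.IH by blast
    moreover have "phi j v1 = phi j w" "phi i v2 = phi i w" using v pres far by blast+
    ultimately show ?thesis using 3 by simp
  qed
qed simp

lemma eA_swap: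
  assumes "Suc i < j \<or> Suc j < i" and "eA i w = Some w1" and "eA j w1 = Some w2"
  shows "\<exists>v. eA j w = Some v \<and> eA i v = Some w2"
proof -
  have "eps j w = eps j w1"
    using eA_splits[OF assms(2)] far_phi_eps(2)[OF assms(1)] by auto
  then obtain v where "eA j w = Some v"
    using eA_None_iff[of j w] eA_None_iff[of j w1] assms(3) by auto
  then show ?thesis using eA_commute[OF assms(1,2)] assms(3) by auto
qed

text \<open>
  The lowering operators are the partial inverses of the raising operators, so this is
  \<open>eA_swap\<close> read backwards.
\<close>

lemma fA_swap:
  assumes "Suc i < j \<or> Suc j < i" and "fA i w = Some w1" and "fA j w1 = Some w2"
  shows "\<exists>v. fA j w = Some v \<and> fA i v = Some w2"
  using eA_swap[of j i w2 w1 w] assms eA_fA fA_eA by blast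

definition highest_weight :: "word \<Rightarrow> bool" where
  "highest_weight w \<longleftrightarrow> (\<forall>i\<ge>1. eps i w = 0)"

text \<open>
  Each raising operator decreases the sum of the letters, so raising must stop at a highest weight
  word. The index 0 is excluded throughout because it would create the letter 0.
\<close>

lemma raise_induct [case_names highest raise]:
  assumes highest: "\<And>w. highest_weight w \<Longrightarrow> P w"
    and raise: "\<And>w i w'. 1 \<le> i \<Longrightarrow> eA i w = Some w' \<Longrightarrow> P w' \<Longrightarrow> P w"
  shows "P w"
proof (induction "sum_list w" arbitrary: w rule: less_induct)
  case less
  show ?case
  proof (cases "highest_weight w")
    case False
    then obtain i where i: "1 \<le> i" "eps i w \<noteq> 0" by (auto simp: highest_weight_def)
    then obtain w' where w': "eA i w = Some w'" using eA_None_iff[of i w] by auto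
    then have "sum_list w' < sum_list w" by (auto dest!: eA_splits)
    then show ?thesis using less raise i w' by blast
  qed (rule highest)
qed

definition e_stable :: "word set \<Rightarrow> bool" where
  "e_stable F \<longleftrightarrow> (\<forall>w\<in>F. \<forall>i\<ge>1. \<forall>w'. eA i w = Some w' \<longrightarrow> w' \<in> F)"

definition f_stable :: "word set \<Rightarrow> bool" where
  "f_stable F \<longleftrightarrow> (\<forall>w\<in>F. \<forall>i\<ge>1. \<forall>w'. fA i w = Some w' \<longrightarrow> w' \<in> F)"

text \<open>
  Raise \<open>w\<close> to highest weight, replace the result by an equivalent word of \<open>S\<close>, and lower the latter along
  the same path; Knuth equivalence is kept at each step.
\<close>

lemma equiv_transport:
  assumes "e_stable F" and "f_stable S"
    and "\<And>w. w \<in> F \<Longrightarrow> highest_weight w \<Longrightarrow> \<exists>s\<in>S. s \<sim> w"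
    and "w \<in> F"
  shows "\<exists>s\<in>S. s \<sim> w"
  using \<open>w \<in> F\<close>
proof (induction w rule: raise_induct)
  case (raise w i w')
  then obtain s' where s': "s' \<in> S" "s' \<sim> w'" using \<open>e_stable F\<close> unfolding e_stable_def by blast
  then obtain s where "fA i s' = Some s" "s \<sim> w"
    using knuth_equiv_fA[of s' w' i] fA_eA[OF raise(2)] by (auto simp: option_rel_Some2)
  then show ?case using s' \<open>f_stable S\<close> \<open>1 \<le> i\<close> unfolding f_stable_def by blast
qed (use assms in blast)

text \<open>
  Raise both words along the same path. The path can be retraced because the raising operators are
  injective. The proposition \<open>Q\<close> stands for a property of the two families that the comparison of highest
  weight words yields as well; for tableaux it is the equality of their shapes.
\<close>

lemma equiv_unique:
  assumes "e_stable F" and "e_stable G"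
    and "\<And>w w'. w \<in> F \<Longrightarrow> w' \<in> G \<Longrightarrow> highest_weight w \<Longrightarrow> highest_weight w' \<Longrightarrow>
      w \<sim> w' \<Longrightarrow> w = w' \<and> Q"
    and "w \<in> F" and "w' \<in> G" and "w \<sim> w'"
  shows "w = w' \<and> Q"
  using assms(4-6)
proof (induction w arbitrary: w' rule: raise_induct)
  case (highest w)
  then have "highest_weight w'" using knuth_equiv_eps by (auto simp: highest_weight_def)
  then show ?case using highest assms by blast
next
  case (raise w i v)
  then obtain v' where v': "eA i w' = Some v'" "v \<sim> v'"
    using knuth_equiv_eA[of w w' i] by (auto simp: option_rel_Some1)
  then have "v = v' \<and> Q" using raise \<open>e_stable F\<close> \<open>e_stable G\<close> unfolding e_stable_def by blast
  then show ?case using fA_eA[OF raise(2)] fA_eA[OF v'(1)] by simp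
qed

section \<open>Columns and semistandard tableaux under crystal operators\<close>

abbreviation column :: "word \<Rightarrow> bool" where "column \<equiv> sorted_wrt (>)"

lemma column_distinct: "column c \<Longrightarrow> distinct c"
  by (induction c) auto

lemma column_phi_eps:
  assumes "column c"
  shows "phi i c = (if i \<in> set c \<and> Suc i \<notin> set c then 1 else 0)"
    and "eps i c = (if Suc i \<in> set c \<and> i \<notin> set c then 1 else 0)"
  using assms
proof (induction c)
  case (Cons a c)
  { case 1 with Cons.IH show ?case by (auto simp: letter_defs) }
  { case 2 with Cons.IH show ?case by (auto simp: letter_defs) }
qed simp_all

lemma column_eA:
  assumes "column c" and "eA i c = Some c'"
  obtains p q where "c = p @ Suc i # q" and "c' = p @ i # q" and "column c'"
    and "Suc i \<in> set c" and "i \<notin> set c"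
proof -
  obtain p q where pq: "c = p @ Suc i # q" "c' = p @ i # q" using eA_splits[OF assms(2)] by blast
  have "i \<notin> set c"
    using eA_None_iff[of i c] assms column_phi_eps(2)[OF assms(1), of i] by (auto split: if_splits)
  moreover have "x < i" if "x \<in> set q" for x
    using assms(1) pq(1) that \<open>i \<notin> set c\<close> by (cases "x = i") (auto simp: sorted_wrt_append)
  then have "column c'"
    using assms(1) unfolding pq by (auto simp: sorted_wrt_append)
  ultimately show ?thesis using that pq by simp
qed

lemma column_fA:
  assumes "column c" and "fA i c = Some c'"
  obtains p q where "c = p @ i # q" and "c' = p @ Suc i # q" and "column c'"
    and "i \<in> set c" and "Suc i \<notin> set c"
proof -
  obtain p q where pq: "c = p @ i # q" "c' = p @ Suc i # q" using fA_splits[OF assms(2)] by blast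
  have "Suc i \<notin> set c"
    using fA_None_iff[of i c] assms column_phi_eps(1)[OF assms(1), of i] by (auto split: if_splits)
  moreover have "x > Suc i" if "x \<in> set p" for x
    using assms(1) pq(1) that \<open>Suc i \<notin> set c\<close> by (cases "x = Suc i") (auto simp: sorted_wrt_append)
  then have "column c'"
    using assms(1) unfolding pq by (auto simp: sorted_wrt_append)
  ultimately show ?thesis using that pq by simp
qed

text \<open>
  Counting the letters below \<open>m\<close>, not up to \<open>m\<close>, makes the count of the letters that precede \<open>i\<close>
  available for \<open>i = 0\<close> too.
\<close>

definition cnt :: "word \<Rightarrow> nat \<Rightarrow> nat" where
  "cnt c m = length (filter (\<lambda>x. x < m) c)"

definition dominates :: "word \<Rightarrow> word \<Rightarrow> bool" where
  "dominates c d \<longleftrightarrow> (\<forall>m. cnt d m \<le> cnt c m)"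

lemma cnt_Suc: "column c \<Longrightarrow> cnt c (Suc m) = cnt c m + (if m \<in> set c then 1 else 0)"
  by (induction c) (auto simp: cnt_def less_Suc_eq)

lemma nth_less_iff_cnt:
  assumes "column c"
  shows "i < length c \<and> rev c ! i < m \<longleftrightarrow> i < cnt c m"
proof -
  have "i < length xs \<and> xs ! i < m \<longleftrightarrow> i < length (filter (\<lambda>x. x < m) xs)"
    if "sorted_wrt (<) xs" for xs
    using that
  proof (induction xs arbitrary: i)
    case (Cons x xs)
    show ?case
    proof (cases "x < m")
      case True
      then show ?thesis using Cons by (cases i) auto
    next
      case False
      then have "filter (\<lambda>x. x < m) (x # xs) = []" using Cons.prems by (fastforce simp: filter_empty_conv)
      moreover have "\<forall>y \<in> set (x # xs). \<not> y < m" using False Cons.prems by fastforce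
      ultimately show ?thesis by (metis list.size(3) not_less_zero nth_mem)
    qed
  qed simp
  from this[of "rev c"] show ?thesis
    using assms by (simp add: cnt_def sorted_wrt_rev rev_filter[symmetric])
qed

text \<open>
  A crystal operator replaces one letter by a neighbour and hence changes a single count by one. This
  makes the condition in terms of counts easier to follow under the operators than the one in terms of rows.
\<close>

lemma dominates_iff_rows:
  assumes "column c" and "column d"
  shows "dominates c d \<longleftrightarrow> length d \<le> length c \<and> (\<forall>i < length d. rev c ! i \<le> rev d ! i)"
proof
  assume dom: "dominates c d"
  have *: "i < length c \<and> rev c ! i \<le> rev d ! i" if "i < length d" for i
  proof -
    have "i < cnt d (Suc (rev d ! i))" using nth_less_iff_cnt[OF assms(2)] that by blast
    then have "i < cnt c (Suc (rev d ! i))" using dom unfolding dominates_def by (meson order_less_le_trans)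
    then show ?thesis using nth_less_iff_cnt[OF assms(1)] less_Suc_eq_le by blast
  qed
  moreover have "length d \<le> length c" using *[of "length c"] by (meson less_irrefl not_le)
  ultimately show "length d \<le> length c \<and> (\<forall>i < length d. rev c ! i \<le> rev d ! i)" by blast
next
  assume rows: "length d \<le> length c \<and> (\<forall>i < length d. rev c ! i \<le> rev d ! i)"
  have "i < cnt c m" if "i < cnt d m" for i m
    using that rows nth_less_iff_cnt[OF assms(1), of i m] nth_less_iff_cnt[OF assms(2), of i m]
    by (meson order_le_less_trans order_less_le_trans)
  then show "dominates c d" unfolding dominates_def by (meson not_less less_irrefl)
qed

lemma semistandard_iff:
  "semistandard T \<longleftrightarrow> (\<forall>c\<in>set T. c \<noteq> [] \<and> column c) \<and> successively dominates T"
proof -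
  have "successively dominates T \<longleftrightarrow> (\<forall>j. Suc j < length T \<longrightarrow>
        length (T ! Suc j) \<le> length (T ! j) \<and>
        (\<forall>i < length (T ! Suc j). rev (T ! j) ! i \<le> rev (T ! Suc j) ! i))"
    if "\<forall>c\<in>set T. column c"
    unfolding successively_conv_nth using that
    by (intro all_cong) (simp add: dominates_iff_rows)
  then show ?thesis unfolding semistandard_def by blast
qed

text \<open>
  The two inequalities are what the tensor product rule says about the factors to the left and to the
  right of the one that is changed.
\<close>

lemma eA_concat:
  assumes "eA i (concat C) = Some w'"
  obtains A c B c' where "C = A @ c # B" and "w' = concat (A @ c' # B)" and "eA i c = Some c'"
    and "eps i (concat A) \<le> phi i (c @ concat B)" and "phi i (concat B) < eps i c"
  using assms
proof (induction C arbitrary: w' thesis)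
  case (Cons c C)
  show ?case
  proof (cases "eps i c > phi i (concat C)")
    case True
    then obtain c' where "eA i c = Some c'" "w' = concat (c' # C)"
      using Cons.prems(2) by (auto simp: eA_append)
    then show ?thesis using Cons.prems(1)[of "[]" c C c'] True by simp
  next
    case False
    then obtain v where v: "eA i (concat C) = Some v" "w' = c @ v"
      using Cons.prems(2) by (auto simp: eA_append)
    obtain A d B d' where d: "C = A @ d # B" "v = concat (A @ d' # B)" "eA i d = Some d'"
      "eps i (concat A) \<le> phi i (d @ concat B)" "phi i (concat B) < eps i d"
      using Cons.IH[OF _ v(1)] by blast
    have "eps i (concat (c # A)) \<le> phi i (d @ concat B)"
      using d False by (auto simp: eps_append phi_append)
    then show ?thesis using Cons.prems(1)[of "c # A" d B d'] d v by simp
  qed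
qed simp

lemma fA_concat:
  assumes "fA i (concat C) = Some w'"
  obtains A c B c' where "C = A @ c # B" and "w' = concat (A @ c' # B)" and "fA i c = Some c'"
    and "phi i (concat B) \<le> eps i c"
  using assms
proof (induction C arbitrary: w' thesis)
  case (Cons c C)
  show ?case
  proof (cases "eps i c \<ge> phi i (concat C)")
    case True
    then obtain c' where "fA i c = Some c'" "w' = concat (c' # C)"
      using Cons.prems(2) by (auto simp: fA_append)
    then show ?thesis using Cons.prems(1)[of "[]" c C c'] True by simp
  next
    case False
    then obtain v where v: "fA i (concat C) = Some v" "w' = c @ v"
      using Cons.prems(2) by (auto simp: fA_append)
    obtain A d B d' where "C = A @ d # B" "v = concat (A @ d' # B)" "fA i d = Some d'"
      "phi i (concat B) \<le> eps i d"
      using Cons.IH[OF _ v(1)] by blast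
    then show ?thesis using Cons.prems(1)[of "c # A" d B d'] v by simp
  qed
qed simp

lemma eA_columns:
  assumes "\<forall>c\<in>set C. column c" and "eA i (concat C) = Some w'"
  shows "\<exists>C'. (\<forall>c\<in>set C'. column c) \<and> map length C' = map length C \<and> concat C' = w'"
proof -
  obtain A c B c' where AB: "C = A @ c # B" "w' = concat (A @ c' # B)" "eA i c = Some c'"
    by (rule eA_concat[OF assms(2)]) (rule that)
  have "column c" using AB assms(1) by simp
  then obtain p q where "c = p @ Suc i # q" "c' = p @ i # q" "column c'"
    using column_eA[OF _ AB(3)] by blast
  then show ?thesis using AB assms(1) by (intro exI[of _ "A @ c' # B"]) auto
qed

lemma fA_columns:
  assumes "\<forall>c\<in>set C. column c" and "fA i (concat C) = Some w'"
  shows "\<exists>C'. (\<forall>c\<in>set C'. column c) \<and> map length C' = map length C \<and> concat C' = w'"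
proof -
  obtain A c B c' where AB: "C = A @ c # B" "w' = concat (A @ c' # B)" "fA i c = Some c'"
    by (rule fA_concat[OF assms(2)]) (rule that)
  have "column c" using AB assms(1) by simp
  then obtain p q where "c = p @ i # q" "c' = p @ Suc i # q" "column c'"
    using column_fA[OF _ AB(3)] by blast
  then show ?thesis using AB assms(1) by (intro exI[of _ "A @ c' # B"]) auto
qed

lemma dominates_eA_left:
  assumes "eA i c = Some c'" and "dominates c d"
  shows "dominates c' d"
proof -
  obtain p q where "c = p @ Suc i # q" "c' = p @ i # q"
    using eA_splits[OF assms(1)] by blast
  then have "cnt c m \<le> cnt c' m" for m by (simp add: cnt_def)
  then show ?thesis using assms(2) unfolding dominates_def by (meson order_trans)
qed

lemma dominates_fA_right:
  assumes "fA i d = Some d'" and "dominates c d"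
  shows "dominates c d'"
proof -
  obtain p q where "d = p @ i # q" "d' = p @ Suc i # q"
    using fA_splits[OF assms(1)] by blast
  then have "cnt d' m \<le> cnt d m" for m by (simp add: cnt_def)
  then show ?thesis using assms(2) unfolding dominates_def by (meson order_trans)
qed

text \<open>
  Raising in \<open>d\<close> increases the count of letters below \<open>i + 1\<close> by one. If the counts of \<open>c\<close> and \<open>d\<close> agreed
  there before, then the neighbouring counts force \<open>c\<close> to contain \<open>i + 1\<close> but not \<open>i\<close>, so that
  \<open>\<epsilon>\<^sub>i(c) = 1\<close>.
\<close>

lemma dominates_eA_right:
  assumes "column c" and "column d" and "eA i d = Some d'" and "dominates c d" and "eps i c = 0"
  shows "dominates c d'"
proof -
  obtain p q where d: "d = p @ Suc i # q" "d' = p @ i # q" "Suc i \<in> set d" "i \<notin> set d"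
    using column_eA[OF assms(2,3)] by blast
  have dom: "cnt d m \<le> cnt c m" for m using assms(4) by (simp add: dominates_def)
  have "cnt d (Suc i) < cnt c (Suc i)"
    using dom[of i] dom[of "Suc i"] dom[of "Suc (Suc i)"] d(3,4) assms(5)
    by (auto simp: cnt_Suc assms(1,2) column_phi_eps split: if_splits)
  moreover have "cnt d' m = cnt d m + (if m = Suc i then 1 else 0)" for m
    by (auto simp: d(1,2) cnt_def)
  ultimately show ?thesis using dom by (auto simp: dominates_def)
qed

text \<open>
  The mirror image of the previous argument: if the counts agreed, then \<open>d\<close> would contain \<open>i\<close> but not
  \<open>i + 1\<close>.
\<close>

lemma dominates_fA_left:
  assumes "column c" and "column d" and "fA i c = Some c'" and "dominates c d" and "phi i d = 0"
  shows "dominates c' d"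
proof -
  obtain p q where c: "c = p @ i # q" "c' = p @ Suc i # q" "i \<in> set c" "Suc i \<notin> set c"
    using column_fA[OF assms(1,3)] by blast
  have dom: "cnt d m \<le> cnt c m" for m using assms(4) by (simp add: dominates_def)
  have "cnt d (Suc i) < cnt c (Suc i)"
    using dom[of i] dom[of "Suc i"] dom[of "Suc (Suc i)"] c(3,4) assms(5)
    by (auto simp: cnt_Suc assms(1,2) column_phi_eps split: if_splits)
  moreover have "cnt c' m = cnt c m - (if m = Suc i then 1 else 0)" for m
    by (auto simp: c(1,2) cnt_def)
  ultimately show ?thesis using dom by (auto simp: dominates_def)
qed

text \<open>
  Only the condition between the changed column and its left neighbour is at risk. If \<open>\<epsilon>\<^sub>i\<close> of that
  neighbour were positive, the tensor product rule would have placed the operator further to the left.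
\<close>

lemma eA_semistandard:
  assumes T: "semistandard T" and e: "eA i (concat T) = Some w'"
  shows "\<exists>T'. semistandard T' \<and> map length T' = map length T \<and> concat T' = w'"
proof -
  obtain A c B c' where AB: "T = A @ c # B" "w' = concat (A @ c' # B)" "eA i c = Some c'"
    and eps: "eps i (concat A) \<le> phi i (c @ concat B)" "phi i (concat B) < eps i c"
    by (rule eA_concat[OF e]) (rule that)
  have col: "\<forall>d\<in>set T. d \<noteq> [] \<and> column d" and succ: "successively dominates T"
    using T by (auto simp: semistandard_iff)
  then have c: "column c" "c \<noteq> []" using AB by auto
  obtain p q where pq: "c = p @ Suc i # q" "c' = p @ i # q" "column c'"
    and i: "Suc i \<in> set c" "i \<notin> set c"
    using column_eA[OF c(1) AB(3)] by blast
  have "eps i (concat A) = 0"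
    using eps column_phi_eps[OF c(1), of i] i by (simp add: phi_append)
  then have "A \<noteq> [] \<Longrightarrow> eps i (last A) = 0"
    by (cases A rule: rev_cases) (auto simp: eps_append)
  then have "A \<noteq> [] \<Longrightarrow> dominates (last A) c'"
    using dominates_eA_right[OF _ c(1) AB(3)] col succ AB(1)
    by (auto simp: successively_append_iff)
  moreover have "B \<noteq> [] \<Longrightarrow> dominates c' (hd B)"
    using dominates_eA_left[OF AB(3)] succ AB(1)
    by (auto simp: successively_append_iff successively_Cons)
  ultimately have "successively dominates (A @ c' # B)"
    using succ AB(1) by (auto simp: successively_append_iff successively_Cons)
  then show ?thesis using col AB pq
    by (intro exI[of _ "A @ c' # B"]) (auto simp: semistandard_iff)
qed

text \<open>
  Here the condition on the right neighbour is at risk, and a positive \<open>\<phi>\<^sub>i\<close> of that neighbour would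
  have placed the operator further to the right.
\<close>

lemma fA_semistandard:
  assumes T: "semistandard T" and f: "fA i (concat T) = Some w'"
  shows "\<exists>T'. semistandard T' \<and> map length T' = map length T \<and> concat T' = w'"
proof -
  obtain A c B c' where AB: "T = A @ c # B" "w' = concat (A @ c' # B)" "fA i c = Some c'"
    and phi: "phi i (concat B) \<le> eps i c"
    by (rule fA_concat[OF f]) (rule that)
  have col: "\<forall>d\<in>set T. d \<noteq> [] \<and> column d" and succ: "successively dominates T"
    using T by (auto simp: semistandard_iff)
  then have c: "column c" "c \<noteq> []" using AB by auto
  obtain p q where pq: "c = p @ i # q" "c' = p @ Suc i # q" "column c'"
    and i: "i \<in> set c" "Suc i \<notin> set c"
    using column_fA[OF c(1) AB(3)] by blast
  have "phi i (concat B) = 0"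
    using phi column_phi_eps[OF c(1), of i] i by simp
  then have "B \<noteq> [] \<Longrightarrow> phi i (hd B) = 0"
    by (cases B) (auto simp: phi_append)
  then have "B \<noteq> [] \<Longrightarrow> dominates c' (hd B)"
    using dominates_fA_left[OF c(1) _ AB(3)] col succ AB(1)
    by (auto simp: successively_append_iff successively_Cons)
  moreover have "A \<noteq> [] \<Longrightarrow> dominates (last A) c'"
    using dominates_fA_right[OF AB(3)] succ AB(1)
    by (auto simp: successively_append_iff)
  ultimately have "successively dominates (A @ c' # B)"
    using succ AB(1) by (auto simp: successively_append_iff successively_Cons)
  then show ?thesis using col AB pq
    by (intro exI[of _ "A @ c' # B"]) (auto simp: semistandard_iff)
qed

section \<open>Uniqueness of tableaux and of column pairs in a Knuth class\<close>

definition column_words :: "nat list \<Rightarrow> word set" where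
  "column_words h = {concat C | C. (\<forall>c\<in>set C. column c) \<and> map length C = h \<and> 0 \<notin> set (concat C)}"

definition tableau_words :: "nat list \<Rightarrow> word set" where
  "tableau_words h = {concat T | T. semistandard T \<and> map length T = h \<and> 0 \<notin> set (concat T)}"

lemma eA_pos: "eA i w = Some w' \<Longrightarrow> 1 \<le> i \<Longrightarrow> 0 \<notin> set w \<Longrightarrow> 0 \<notin> set w'"
  by (auto dest: eA_splits)

lemma fA_pos: "fA i w = Some w' \<Longrightarrow> 0 \<notin> set w \<Longrightarrow> 0 \<notin> set w'"
  by (auto dest: fA_splits)

lemma column_words_stable: "e_stable (column_words h)" "f_stable (column_words h)"
proof -
  show "e_stable (column_words h)"
    unfolding e_stable_def
  proof (intro ballI allI impI)
    fix w i w' assume "w \<in> column_words h" and i: "1 \<le> i" and e: "eA i w = Some w'"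
    then obtain C where C: "w = concat C" "\<forall>c\<in>set C. column c" "map length C = h" "0 \<notin> set w"
      by (auto simp: column_words_def)
    then have "\<exists>C'. (\<forall>c\<in>set C'. column c) \<and> map length C' = map length C \<and> concat C' = w'"
      using eA_columns e by blast
    then show "w' \<in> column_words h"
      using C eA_pos[OF e i] by (auto simp: column_words_def)
  qed
  show "f_stable (column_words h)"
    unfolding f_stable_def
  proof (intro ballI allI impI)
    fix w i w' assume "w \<in> column_words h" and i: "1 \<le> i" and f: "fA i w = Some w'"
    then obtain C where C: "w = concat C" "\<forall>c\<in>set C. column c" "map length C = h" "0 \<notin> set w"
      by (auto simp: column_words_def)
    then have "\<exists>C'. (\<forall>c\<in>set C'. column c) \<and> map length C' = map length C \<and> concat C' = w'"
      using fA_columns f by blast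
    then show "w' \<in> column_words h"
      using C fA_pos[OF f] by (auto simp: column_words_def)
  qed
qed

lemma tableau_words_stable: "e_stable (tableau_words h)" "f_stable (tableau_words h)"
proof -
  show "e_stable (tableau_words h)"
    unfolding e_stable_def
  proof (intro ballI allI impI)
    fix w i w' assume "w \<in> tableau_words h" and i: "1 \<le> i" and e: "eA i w = Some w'"
    then obtain T where T: "w = concat T" "semistandard T" "map length T = h" "0 \<notin> set w"
      by (auto simp: tableau_words_def)
    then have "\<exists>T'. semistandard T' \<and> map length T' = map length T \<and> concat T' = w'"
      using eA_semistandard e by blast
    then show "w' \<in> tableau_words h"
      using T eA_pos[OF e i] by (auto simp: tableau_words_def)
  qed
  show "f_stable (tableau_words h)"
    unfolding f_stable_def
  proof (intro ballI allI impI)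
    fix w i w' assume "w \<in> tableau_words h" and i: "1 \<le> i" and f: "fA i w = Some w'"
    then obtain T where T: "w = concat T" "semistandard T" "map length T = h" "0 \<notin> set w"
      by (auto simp: tableau_words_def)
    then have "\<exists>T'. semistandard T' \<and> map length T' = map length T \<and> concat T' = w'"
      using fA_semistandard f by blast
    then show "w' \<in> tableau_words h"
      using T fA_pos[OF f] by (auto simp: tableau_words_def)
  qed
qed

lemma set_interval_column:
  assumes "c = rev [1..<length c + 1]"
  shows "set c = {1..length c}"
proof -
  have "set c = set (rev [1..<length c + 1])" by (rule arg_cong[OF assms])
  also have "\<dots> = {1..length c}" by auto
  finally show ?thesis .
qed

lemma interval_column:
  assumes "column c" and "0 \<notin> set c" and "\<And>a. Suc a \<in> set c \<Longrightarrow> 0 < a \<Longrightarrow> a \<in> set c"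
  shows "c = rev [1..<length c + 1]"
  using assms
proof (induction c)
  case (Cons a c)
  have "x \<in> set c" if "Suc x \<in> set c" "0 < x" for x
    using Cons.prems(1) Cons.prems(3)[of x] that by auto
  moreover have "column c" "0 \<notin> set c" using Cons.prems(1,2) by auto
  ultimately have c: "c = rev [1..<length c + 1]" using Cons.IH by blast
  then have set_c: "set c = {1..length c}" by (rule set_interval_column)
  have "a > length c" using set_c Cons.prems(1,2) by (cases "length c = 0") auto
  moreover have "a \<le> Suc (length c)"
    using Cons.prems(3)[of "a - 1"] set_c Cons.prems(2) by (cases a) force+
  ultimately have "a = Suc (length c)" by simp
  then show ?case using c by simp
qed simp

lemma highest_column:
  assumes "column c" and "0 \<notin> set c" and "highest_weight c"
  shows "c = rev [1..<length c + 1]"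
proof (rule interval_column[OF assms(1,2)])
  fix a assume "Suc a \<in> set c" "0 < a"
  moreover from this have "eps a c = 0" using assms(3) by (simp add: highest_weight_def)
  ultimately show "a \<in> set c" using column_phi_eps(2)[OF assms(1), of a] by (auto split: if_splits)
qed

lemma highest_weight_append: "highest_weight (v @ w) \<Longrightarrow> highest_weight w"
  by (simp add: highest_weight_def eps_append)

lemma phi_pos_mem: "0 < phi i w \<Longrightarrow> i \<in> set w"
  by (induction w) (auto simp: letter_defs split: if_splits)

lemma dominates_trans: "dominates c d \<Longrightarrow> dominates d e \<Longrightarrow> dominates c e"
  unfolding dominates_def by (meson order_trans)

lemma semistandard_Cons:
  "semistandard (c # T) \<longleftrightarrow> c \<noteq> [] \<and> column c \<and> (\<forall>d\<in>set T. dominates c d) \<and> semistandard T"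
proof -
  have "transp dominates" using dominates_trans by (rule transpI)
  then show ?thesis by (auto simp: semistandard_iff successively_conv_sorted_wrt)
qed

lemma cnt_0: "cnt c 0 = 0"
  by (simp add: cnt_def)

lemma cnt_bounds:
  assumes "column c"
  shows "0 \<notin> set c \<Longrightarrow> cnt c m \<le> m - 1"
    and "(\<And>x. 1 \<le> x \<Longrightarrow> x \<le> m \<Longrightarrow> x \<in> set c) \<Longrightarrow> m \<le> cnt c (Suc m)"
proof (induction m)
  case (Suc m)
  { case 1 with Suc(1) show ?case by (cases m) (auto simp: cnt_Suc[OF assms] cnt_0) }
  { case 2 with Suc(2) show ?case by (auto simp: cnt_Suc[OF assms]) }
qed (simp_all add: cnt_0)

text \<open>
  From right to left: suppose that \<open>c\<close> contains \<open>a + 1\<close> but not \<open>a\<close>. Highest weight demands a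
  factor further right with a letter \<open>a\<close>. That column is an interval, so it has \<open>a\<close> letters up to \<open>a\<close>, while \<open>c\<close>
  has at most \<open>a - 1\<close> of them, against semistandardness.
\<close>

lemma highest_tableau:
  assumes "semistandard T" and "0 \<notin> set (concat T)" and "highest_weight (concat T)"
  shows "\<forall>c\<in>set T. c = rev [1..<length c + 1]"
  using assms
proof (induction T)
  case (Cons c T)
  have c: "column c" "0 \<notin> set c" and dom: "\<forall>d\<in>set T. dominates c d" and T: "semistandard T"
    using Cons.prems by (auto simp: semistandard_Cons)
  have IH: "\<forall>d\<in>set T. d = rev [1..<length d + 1]"
    using Cons.IH[OF T] Cons.prems highest_weight_append by auto
  have "c = rev [1..<length c + 1]"
  proof (rule interval_column[OF c])
    fix a assume a: "Suc a \<in> set c" "0 < a"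
    show "a \<in> set c"
    proof (rule ccontr)
      assume "a \<notin> set c"
      then have "eps a c = 1" using a column_phi_eps(2)[OF c(1), of a] by simp
      moreover have "eps a (c @ concat T) = 0"
        using Cons.prems(3) a by (simp add: highest_weight_def)
      ultimately have "0 < phi a (concat T)" by (simp add: eps_append)
      then have "a \<in> set (concat T)" by (rule phi_pos_mem)
      then obtain d where d: "d \<in> set T" "a \<in> set d" by auto
      then have "set d = {1..length d}" using IH set_interval_column by blast
      then have "x \<in> set d" if "1 \<le> x" "x \<le> a" for x using d(2) that by auto
      then have "a \<le> cnt d (Suc a)" using cnt_bounds(2) d(1) T by (auto simp: semistandard_iff)
      also have "\<dots> \<le> cnt c (Suc a)" using dom d(1) by (auto simp: dominates_def)
      also have "\<dots> \<le> a - 1" using cnt_Suc[OF c(1)] \<open>a \<notin> set c\<close> cnt_bounds(1)[OF c] by simp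
      finally show False using \<open>0 < a\<close> by simp
    qed
  qed
  then show ?case using IH by simp
qed simp

text \<open>
  The first column contains all the letters of the tableau, so the content determines its height.
\<close>

lemma highest_tableau_unique:
  assumes "semistandard T" and "semistandard T'"
    and "\<forall>c\<in>set T. c = rev [1..<length c + 1]" and "\<forall>c\<in>set T'. c = rev [1..<length c + 1]"
    and "mset (concat T) = mset (concat T')"
  shows "T = T'"
  using assms
proof (induction T arbitrary: T')
  case Nil
  then show ?case by (cases T') (auto simp: semistandard_Cons)
next
  case (Cons c T)
  then obtain d U where T': "T' = d # U" by (cases T') (auto simp: semistandard_Cons)
  have first: "card (set (concat (c # T))) = length c"
    if "semistandard (c # T)" and "\<forall>c\<in>set (c # T). c = rev [1..<length c + 1]" for c T
  proof -
    have "set d \<subseteq> set c" if "d \<in> set T" for d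
    proof -
      have "set d = {1..length d}" "set c = {1..length c}"
        using \<open>\<forall>c\<in>set (c # T). c = rev [1..<length c + 1]\<close> that set_interval_column by auto
      moreover have "semistandard T" "dominates c d" "column c"
        using that \<open>semistandard (c # T)\<close> by (simp_all add: semistandard_Cons)
      moreover from this(1) have "column d" using that by (simp add: semistandard_iff)
      ultimately have "set d = {1..length d}" "set c = {1..length c}" "length d \<le> length c"
        using dominates_iff_rows[of c d] by blast+
      then show ?thesis by auto
    qed
    then have "set (concat (c # T)) = set c" by auto
    moreover have "card (set c) = length c"
      using that(2) set_interval_column[of c] by simp
    ultimately show ?thesis by metis
  qed
  have "length c = length d"
    using first[of c T] first[of d U] Cons.prems T' by (metis set_mset_mset)
  then have "c = d" using Cons.prems(3,4) T' by (metis list.set_intros(1))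
  moreover have "T = U"
    using Cons.IH[of U] Cons.prems T' \<open>c = d\<close> by (auto simp: semistandard_Cons)
  ultimately show ?case using T' by simp
qed

lemma concat_shape_eq: "concat C = concat D \<Longrightarrow> map length C = map length D \<Longrightarrow> C = D"
proof (induction C arbitrary: D)
  case (Cons c C)
  then show ?case by (cases D) auto
qed simp

text \<open>
  Two highest weight tableaux with the same content coincide, shape included. The equality of the
  shapes is carried back as \<open>Q\<close>, and the tableau is then recovered from its reading word and its shape.
\<close>

lemma tableau_unique:
  assumes "semistandard T" and "semistandard T'" and "0 \<notin> set (concat T)" and "concat T \<sim> concat T'"
  shows "T = T'"
proof -
  let ?h = "map length T" and ?h' = "map length T'"
  have pos: "0 \<notin> set (concat T')"
    using knuth_equiv_mset[OF assms(4)] assms(3) by (metis set_mset_mset)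
  have "concat T = concat T' \<and> ?h = ?h'"
  proof (rule equiv_unique[OF tableau_words_stable(1)[of ?h] tableau_words_stable(1)[of ?h']])
    fix w w' assume *: "w \<in> tableau_words ?h" "w' \<in> tableau_words ?h'"
      "highest_weight w" "highest_weight w'" "w \<sim> w'"
    obtain U where U: "w = concat U" "semistandard U" "map length U = ?h" "0 \<notin> set (concat U)"
      using *(1) unfolding tableau_words_def by blast
    obtain U' where U': "w' = concat U'" "semistandard U'" "map length U' = ?h'" "0 \<notin> set (concat U')"
      using *(2) unfolding tableau_words_def by blast
    have "U = U'"
      using highest_tableau_unique[OF U(2) U'(2)] highest_tableau U U' * knuth_equiv_mset by blast
    then show "w = w' \<and> ?h = ?h'" using U U' by metis
  qed (use assms pos in \<open>auto simp: tableau_words_def\<close>)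
  then show ?thesis using concat_shape_eq by blast
qed

lemma column_eqI: "column c \<Longrightarrow> column d \<Longrightarrow> set c = set d \<Longrightarrow> c = d"
  using strict_sorted_equal[of "rev c" "rev d"] by (simp add: sorted_wrt_rev)

text \<open>
  In a highest weight word the right factor is highest weight itself, hence an interval determined by
  its height; then the content determines the left factor.
\<close>

lemma column_pair_unique:
  assumes c: "column c1" "column c2" "0 \<notin> set (c1 @ c2)"
    and d: "column d1" "column d2" "length d1 = length c1" "length d2 = length c2"
    and eq: "c1 @ c2 \<sim> d1 @ d2"
  shows "c1 = d1 \<and> c2 = d2"
proof -
  let ?F = "column_words [length c1, length c2]"
  have pos: "0 \<notin> set (d1 @ d2)"
    using knuth_equiv_mset[OF eq] c(3) by (metis set_mset_mset)
  have "c1 @ c2 = d1 @ d2 \<and> True"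
  proof (rule equiv_unique[OF column_words_stable(1)[of "[length c1, length c2]"]
        column_words_stable(1)[of "[length c1, length c2]"]])
    fix w w' assume *: "w \<in> ?F" "w' \<in> ?F" "highest_weight w" "highest_weight w'" "w \<sim> w'"
    have split: "\<exists>x1 x2. v = x1 @ x2 \<and> column x1 \<and> column x2 \<and> x2 = rev [1..<length c2 + 1]"
      if v: "v \<in> ?F" "highest_weight v" for v
    proof -
      obtain C where C: "v = concat C" "\<forall>c\<in>set C. column c"
        "map length C = [length c1, length c2]" "0 \<notin> set (concat C)"
        using v(1) unfolding column_words_def mem_Collect_eq by (elim exE conjE) (rule that)
      then obtain x1 x2 where x: "C = [x1, x2]" "length x2 = length c2" by auto
      then have "x2 = rev [1..<length x2 + 1]"
        using C v(2) highest_weight_append[of x1 x2] by (intro highest_column) auto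
      then show ?thesis using C x by auto
    qed
    obtain x1 x2 where x: "w = x1 @ x2" "column x1" "column x2" "x2 = rev [1..<length c2 + 1]"
      using split * by blast
    obtain y1 y2 where y: "w' = y1 @ y2" "column y1" "column y2" "y2 = rev [1..<length c2 + 1]"
      using split * by blast
    have "mset x1 = mset y1" using knuth_equiv_mset[OF *(5)] x y by simp
    then have "x1 = y1" using column_eqI x y by (metis set_mset_mset)
    then show "w = w' \<and> True" using x y by simp
  next
    show "c1 @ c2 \<in> ?F" using c unfolding column_words_def by (auto intro!: exI[of _ "[c1, c2]"])
    show "d1 @ d2 \<in> ?F" using d pos unfolding column_words_def by (auto intro!: exI[of _ "[d1, d2]"])
  qed (rule eq)
  then show ?thesis using d by simp
qed

section \<open>Existence of tableaux and the local isomorphism\<close>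

lemma knuth_letter_into_column: "column (p @ [y]) \<Longrightarrow> x \<le> y \<Longrightarrow> x # p @ [y] \<sim> p @ [x, y]"
proof (induction p)
  case (Cons z p)
  obtain h t where ht: "p @ [y] = h # t" by (cases "p @ [y]") auto
  then have "h \<in> set (p @ [y])" by simp
  then have "y \<le> h" "h < z" using Cons.prems(1) by (auto simp: sorted_wrt_append)
  then have "[x, z, h] @ t \<sim> [z, x, h] @ t"
    using Cons.prems(2) by (intro knuth_equiv_append_right knuth_swap_first) auto
  then have "x # z # p @ [y] \<sim> [z] @ (x # p @ [y])" using ht by simp
  also have "\<dots> \<sim> [z] @ (p @ [x, y])"
    using Cons by (intro knuth_equiv_append_left) auto
  finally show ?case by simp
qed simp

lemma knuth_letter_past_column: "column (y # q) \<Longrightarrow> y \<le> z \<Longrightarrow> y # z # q \<sim> y # q @ [z]"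
proof (induction q arbitrary: y)
  case (Cons x q)
  then have "[y, z, x] @ q \<sim> [y, x, z] @ q"
    by (intro knuth_equiv_append_right knuth_swap_last) auto
  then have "y # z # x # q \<sim> [y] @ (x # z # q)" by simp
  also have "\<dots> \<sim> [y] @ (x # q @ [z])"
    using Cons by (intro knuth_equiv_append_left) auto
  finally show ?case by simp
qed simp

text \<open>
  The letter \<open>a\<close> moves right past the larger letters of \<open>c\<close> until it meets the copy of \<open>a\<close> in \<open>c\<close>. Of
  the two adjacent letters \<open>a\<close> one then stays in the column, which leaves the other free to move past the smaller
  letters.
\<close>

lemma column_commutes_letter:
  assumes "column c" and "a \<in> set c"
  shows "a # c \<sim> c @ [a]"
proof -
  obtain p q where c: "c = p @ a # q" using assms(2) split_list by fast
  have "(a # p @ [a]) @ q \<sim> (p @ [a, a]) @ q"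
    using assms(1) c by (intro knuth_equiv_append_right knuth_letter_into_column) (auto simp: sorted_wrt_append)
  also have "(p @ [a, a]) @ q = p @ (a # a # q)" by simp
  also have "\<dots> \<sim> p @ (a # q @ [a])"
    using assms(1) c by (intro knuth_equiv_append_left knuth_letter_past_column) (auto simp: sorted_wrt_append)
  finally show ?thesis using c by simp
qed

lemma column_commutes_word:
  assumes "column c" and "set q \<subseteq> set c"
  shows "q @ c \<sim> c @ q"
  using assms(2)
proof (induction q)
  case (Cons a q)
  then have "[a] @ (q @ c) \<sim> [a] @ (c @ q)" by (intro knuth_equiv_append_left) auto
  also have "[a] @ (c @ q) = (a # c) @ q" by simp
  also have "\<dots> \<sim> (c @ [a]) @ q"
    using Cons.prems assms(1) by (intro knuth_equiv_append_right column_commutes_letter) auto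
  finally show ?case by simp
qed simp

lemma dominates_if_subset:
  assumes "column c" and "column d" and "set d \<subseteq> set c"
  shows "dominates c d"
proof -
  have "cnt e m = card {x \<in> set e. x < m}" if "column e" for e m
  proof -
    have "distinct (filter (\<lambda>x. x < m) e)" using column_distinct[OF that] by simp
    then show ?thesis unfolding cnt_def by (metis distinct_card set_filter)
  qed
  moreover have "card {x \<in> set d. x < m} \<le> card {x \<in> set c. x < m}" for m
    using assms(3) by (intro card_mono) auto
  ultimately show ?thesis using assms unfolding dominates_def by simp
qed

lemma in_column_words_pair:
  "w \<in> column_words [k, l] \<longleftrightarrow>
     (\<exists>c d. w = c @ d \<and> column c \<and> column d \<and> length c = k \<and> length d = l \<and> 0 \<notin> set w)"
proof
  assume "w \<in> column_words [k, l]"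
  then obtain C where "w = concat C" "\<forall>c\<in>set C. column c" "map length C = [k, l]" "0 \<notin> set (concat C)"
    unfolding column_words_def mem_Collect_eq by (elim exE conjE) (rule that)
  moreover from this(3) obtain c d where "C = [c, d]" "length c = k" "length d = l" by auto
  ultimately show "\<exists>c d. w = c @ d \<and> column c \<and> column d \<and> length c = k \<and> length d = l \<and> 0 \<notin> set w"
    by (intro exI[of _ c] exI[of _ d]) simp
next
  assume "\<exists>c d. w = c @ d \<and> column c \<and> column d \<and> length c = k \<and> length d = l \<and> 0 \<notin> set w"
  then obtain c d where "w = c @ d" "column c" "column d" "length c = k" "length d = l" "0 \<notin> set w"
    by blast
  then show "w \<in> column_words [k, l]" unfolding column_words_def by (auto intro!: exI[of _ "[c, d]"])
qed

lemma column_filter_split: "column c \<Longrightarrow> c = filter (\<lambda>x. k < x) c @ filter (\<lambda>x. x \<le> k) c" for k :: nat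
proof (induction c)
  case (Cons a c)
  show ?case
  proof (cases "k < a")
    case False
    then have "filter (\<lambda>x. k < x) c = []" using Cons.prems by (auto simp: filter_empty_conv)
    then show ?thesis using Cons False by auto
  qed (use Cons in auto)
qed simp

lemma tableau_wordsI: "semistandard T \<Longrightarrow> 0 \<notin> set (concat T) \<Longrightarrow> concat T \<in> tableau_words (map length T)"
  unfolding tableau_words_def by blast

text \<open>
  At highest weight the right column is \<open>1, \<dots>, k\<close>. The letters of the left column that do not exceed \<open>k\<close>
  commute with it, and the larger ones extend it to a longer column. What results is a
  tableau, except that one or both of its columns may be empty.
\<close>

lemma two_columns_to_tableau:
  assumes "column c1" and "column c2" and "0 \<notin> set (c1 @ c2)"
  shows "\<exists>T. semistandard T \<and> concat T \<sim> c1 @ c2"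
proof -
  let ?F = "column_words [length c1, length c2]" and ?S = "\<Union>h. tableau_words h"
  have "f_stable ?S" using tableau_words_stable(2) unfolding f_stable_def by blast
  moreover have "\<exists>s\<in>?S. s \<sim> w" if w: "w \<in> ?F" "highest_weight w" for w
  proof -
    obtain x1 x2 where x: "w = x1 @ x2" "column x1" "column x2" "0 \<notin> set w"
      using w(1) unfolding in_column_words_pair by blast
    let ?k = "length x2"
    have "x2 = rev [1..<?k + 1]" using x w(2) highest_weight_append by (intro highest_column) auto
    then have set_x2: "set x2 = {1..?k}" by (rule set_interval_column)
    define p where "p = filter (\<lambda>x. ?k < x) x1"
    define q where "q = filter (\<lambda>x. x \<le> ?k) x1"
    have x1: "x1 = p @ q" unfolding p_def q_def using x(2) by (rule column_filter_split)
    have q: "set q \<subseteq> set x2"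
    proof
      fix a assume "a \<in> set q"
      then have "a \<in> set x1" "a \<le> ?k" by (simp_all add: q_def)
      moreover from this(1) have "a \<noteq> 0" using x(1,4) by (intro notI) simp
      ultimately show "a \<in> set x2" by (simp add: set_x2)
    qed
    have "column (p @ q)" using x(2) x1 by metis
    moreover have "\<forall>a\<in>set p. ?k < a" by (simp add: p_def)
    ultimately have cols: "column (p @ x2)" "column q"
      using x(3) set_x2 by (auto simp: sorted_wrt_append)
    have "dominates (p @ x2) q" using cols q by (intro dominates_if_subset) auto
    (* Tableaux have nonempty columns, so an empty one is dropped. *)
    define T where "T = filter (\<lambda>c. c \<noteq> []) [p @ x2, q]"
    have "semistandard T" and concat: "concat T = p @ x2 @ q"
      using cols q \<open>dominates (p @ x2) q\<close> by (auto simp: semistandard_iff T_def)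
    have "set (p @ x2 @ q) = set (x1 @ x2)" unfolding x1 by auto
    then have "0 \<notin> set (concat T)" unfolding concat using x(1,4) by metis
    then have "concat T \<in> ?S" using tableau_wordsI[OF \<open>semistandard T\<close>] by blast
    then have "p @ (x2 @ q) \<in> ?S" by (simp only: concat)
    moreover have "p @ (x2 @ q) \<sim> p @ (q @ x2)"
      by (rule knuth_equiv_append_left[OF knuth_equiv_sym[OF column_commutes_word[OF x(3) q]]])
    moreover have "w = p @ (q @ x2)" using x(1) x1 by (metis append_assoc)
    ultimately show ?thesis by blast
  qed
  moreover have "c1 @ c2 \<in> ?F" using assms unfolding in_column_words_pair by blast
  ultimately obtain s where "s \<in> ?S" "s \<sim> c1 @ c2"
    using equiv_transport[OF column_words_stable(1)] by meson
  then show ?thesis unfolding tableau_words_def by blast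
qed

text \<open>
  At highest weight both columns are initial intervals, one contained in the other, so they commute.
\<close>

lemma tableau_column_swap:
  assumes "semistandard [u, v]" and "0 \<notin> set (u @ v)"
  shows "\<exists>v' u'. column v' \<and> column u' \<and> length v' = length v \<and> length u' = length u \<and> v' @ u' \<sim> u @ v"
proof -
  let ?F = "tableau_words [length u, length v]" and ?S = "column_words [length v, length u]"
  have "\<exists>s\<in>?S. s \<sim> w" if w: "w \<in> ?F" "highest_weight w" for w
  proof -
    obtain T where T: "w = concat T" "semistandard T" "map length T = [length u, length v]" "0 \<notin> set (concat T)"
      using w(1) unfolding tableau_words_def mem_Collect_eq by (elim exE conjE) (rule that)
    then obtain x y where xy: "T = [x, y]" "length x = length u" "length y = length v" by auto
    have "x = rev [1..<length x + 1]" "y = rev [1..<length y + 1]"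
      using highest_tableau[OF T(2,4)] T(1) w(2) xy(1) by auto
    then have "set x = {1..length x}" "set y = {1..length y}" using set_interval_column by blast+
    moreover have cols: "column x" "column y" "length y \<le> length x"
      using T(2) xy(1) dominates_iff_rows[of x y] by (auto simp: semistandard_iff)
    ultimately have "y @ x \<sim> x @ y" by (intro column_commutes_word) auto
    moreover have "y @ x \<in> ?S" unfolding in_column_words_pair using cols xy T(4) by auto
    ultimately show ?thesis using T(1) xy(1) by auto
  qed
  moreover have "u @ v \<in> ?F" using assms unfolding tableau_words_def by (auto intro!: exI[of _ "[u, v]"])
  ultimately obtain s where "s \<in> ?S" "s \<sim> u @ v"
    using equiv_transport[OF tableau_words_stable(1) column_words_stable(2)] by meson
  then show ?thesis unfolding in_column_words_pair by blast
qed

text \<open>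
  Existence of the tableau is essential for the direction from left to right: without it the
  description would not determine anything about the words.
\<close>

lemma schensted_tableau_eq_iff:
  assumes c: "column c1" "column c2" "0 \<notin> set (c1 @ c2)"
    and d: "column d1" "column d2" "0 \<notin> set (d1 @ d2)"
  shows "schensted_tableau (c1 @ c2) = schensted_tableau (d1 @ d2) \<longleftrightarrow> c1 @ c2 \<sim> d1 @ d2"
proof
  have P: "concat (schensted_tableau (x @ y)) \<sim> x @ y"
    if xy: "column x" "column y" "0 \<notin> set (x @ y)" for x y
  proof -
    obtain T where T: "semistandard T" "concat T \<sim> x @ y"
      using two_columns_to_tableau[OF xy] by blast
    have "T' = T" if "semistandard T'" "concat T' \<sim> x @ y" for T'
    proof (rule tableau_unique[OF that(1) T(1)])
      show "concat T' \<sim> concat T" using that(2) T(2) knuth_equiv_sym knuth_equiv_trans by blast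
      show "0 \<notin> set (concat T')"
        using knuth_equiv_mset[OF that(2)] xy(3) by (metis set_mset_mset)
    qed
    then have "schensted_tableau (x @ y) = T"
      unfolding schensted_tableau_def using T by (intro the_equality) blast+
    then show ?thesis using T by simp
  qed
  assume "schensted_tableau (c1 @ c2) = schensted_tableau (d1 @ d2)"
  then show "c1 @ c2 \<sim> d1 @ d2"
    using P[OF c] P[OF d] knuth_equiv_sym knuth_equiv_trans by metis
next
  assume "c1 @ c2 \<sim> d1 @ d2"
  then have "w \<sim> c1 @ c2 \<longleftrightarrow> w \<sim> d1 @ d2" for w
    using knuth_equiv_sym knuth_equiv_trans by blast
  then show "schensted_tableau (c1 @ c2) = schensted_tableau (d1 @ d2)"
    unfolding schensted_tableau_def by simp
qed

text \<open>
  The pair that \<open>\<sigma>\<close> selects exists by \<open>tableau_column_swap\<close>; any other pair of columns of these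
  heights in the Knuth class coincides with it by \<open>column_pair_unique\<close>.
\<close>

lemma local_iso_eq_iff:
  assumes u: "u \<in> columns n (2 * n - r)" and v: "v \<in> columns n r" and T: "semistandard [u, v]"
    and v': "v' \<in> columns n r" and u': "u' \<in> columns n (2 * n - r)"
  shows "local_iso n r (u, v) = (v', u') \<longleftrightarrow> u @ v \<sim> v' @ u'"
proof -
  have cols: "column c" "0 \<notin> set c" "length c = k" "set c \<subseteq> {1..2 * n}" if "c \<in> columns n k" for c k
    using that by (auto simp: columns_def)
  let ?P = "\<lambda>b'. b' \<in> columns n r \<times> columns n (2 * n - r) \<and>
      schensted_tableau (u @ v) = schensted_tableau (fst b' @ snd b')"
  have P: "?P (x, y) \<longleftrightarrow> x \<in> columns n r \<and> y \<in> columns n (2 * n - r) \<and> u @ v \<sim> x @ y" for x y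
    using schensted_tableau_eq_iff[of u v x y] cols u v by auto
  obtain x y where xy: "column x" "column y" "length x = length v" "length y = length u" "x @ y \<sim> u @ v"
    using tableau_column_swap[OF T] cols u v by auto
  have "set (x @ y) = set (u @ v)" using knuth_equiv_mset[OF xy(5)] by (metis set_mset_mset)
  then have "set x \<subseteq> {1..2 * n}" "set y \<subseteq> {1..2 * n}" using cols(4)[OF u] cols(4)[OF v] by auto
  then have Pxy: "?P (x, y)"
    unfolding P using xy cols(3)[OF u] cols(3)[OF v] knuth_equiv_sym by (auto simp: columns_def)
  have uniq: "b' = (x, y)" if "?P b'" for b'
  proof -
    obtain x' y' where b': "b' = (x', y')" by (cases b')
    then have "x' \<in> columns n r" "y' \<in> columns n (2 * n - r)" "u @ v \<sim> x' @ y'" using that P by auto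
    then have "x = x' \<and> y = y'"
      using xy cols u v Pxy knuth_equiv_trans[OF xy(5)]
      by (intro column_pair_unique) (auto simp: P)
    then show ?thesis using b' by simp
  qed
  then have "local_iso n r (u, v) = (x, y)"
    unfolding local_iso_def fst_conv snd_conv by (intro the_equality Pxy)
  moreover have "u @ v \<sim> v' @ u'" if "(x, y) = (v', u')" using Pxy that unfolding P by blast
  moreover have "(v', u') = (x, y)" if "u @ v \<sim> v' @ u'" using uniq[of "(v', u')"] P u' v' that by blast
  ultimately show ?thesis by metis
qed

section \<open>Self-dual tableaux and the virtual crystal\<close>

lemma set_vee_star:
  "x \<in> set (column_vee_star n c) \<longleftrightarrow> 1 \<le> x \<and> x \<le> 2 * n \<and> 2 * n + 1 - x \<notin> set c"
proof -
  have "finite {2 * n + 1 - i | i. i \<in> {1..2 * n} \<and> i \<notin> set c}" by simp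
  then have "x \<in> set (column_vee_star n c) \<longleftrightarrow> (\<exists>i. x = 2 * n + 1 - i \<and> i \<in> {1..2 * n} \<and> i \<notin> set c)"
    unfolding column_vee_star_def by simp
  also have "\<dots> \<longleftrightarrow> 1 \<le> x \<and> x \<le> 2 * n \<and> 2 * n + 1 - x \<notin> set c"
    by (auto intro!: exI[of _ "2 * n + 1 - x"])
  finally show ?thesis .
qed

lemma column_vee_star_columns:
  assumes "c \<in> columns n k"
  shows "column_vee_star n c \<in> columns n (2 * n - k)"
proof -
  have c: "set c \<subseteq> {1..2 * n}" "card (set c) = k"
    using assms column_distinct[of c] distinct_card[of c] by (auto simp: columns_def)
  have "{2 * n + 1 - i | i. i \<in> {1..2 * n} \<and> i \<notin> set c} = (\<lambda>i. 2 * n + 1 - i) ` ({1..2 * n} - set c)"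
    by auto
  moreover have "inj_on (\<lambda>i. 2 * n + 1 - i) ({1..2 * n} - set c)"
    by (rule inj_onI) auto
  ultimately have "length (column_vee_star n c) = card ({1..2 * n} - set c)"
    unfolding column_vee_star_def by (simp add: card_image)
  then have "length (column_vee_star n c) = 2 * n - k"
    using c by (simp add: card_Diff_subset)
  moreover have "column (column_vee_star n c)"
    unfolding column_vee_star_def by (simp add: sorted_wrt_rev)
  moreover have "set (column_vee_star n c) \<subseteq> {1..2 * n}" using set_vee_star by auto
  ultimately show ?thesis unfolding columns_def by blast
qed

lemma columnsD:
  assumes "c \<in> columns n k"
  shows "column c" and "length c = k" and "set c \<subseteq> {1..2 * n}" and "0 \<notin> set c"
  using assms by (auto simp: columns_def)

text \<open>
  Complementation exchanges presence and absence of letters and the reflection exchanges the roles of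
  \<open>i\<close> and \<open>i + 1\<close>, so both together preserve the signature.
\<close>

lemma vee_star_phi_eps:
  assumes "c \<in> columns n k" and "1 \<le> i" and "i < 2 * n"
  shows "phi (2 * n - i) (column_vee_star n c) = phi i c"
    and "eps (2 * n - i) (column_vee_star n c) = eps i c"
proof -
  have "2 * n - i \<in> set (column_vee_star n c) \<longleftrightarrow> Suc i \<notin> set c"
    using assms set_vee_star[of "2 * n - i" n c] by (simp add: Suc_diff_le Suc_leI)
  moreover have "Suc (2 * n - i) \<in> set (column_vee_star n c) \<longleftrightarrow> i \<notin> set c"
  proof -
    have "Suc (2 * n - i) \<le> 2 * n" and "2 * n + 1 - Suc (2 * n - i) = i" using assms by auto
    then show ?thesis using set_vee_star[of "Suc (2 * n - i)" n c] by simp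
  qed
  moreover have "column c" "column (column_vee_star n c)"
    using columnsD(1) column_vee_star_columns assms(1) by blast+
  ultimately show "phi (2 * n - i) (column_vee_star n c) = phi i c"
    and "eps (2 * n - i) (column_vee_star n c) = eps i c"
    by (simp_all add: column_phi_eps)
qed

lemma column_eA_set:
  assumes "column c" and "eA i c = Some c'"
  shows "set c' = insert i (set c - {Suc i})"
proof -
  obtain p q where "c = p @ Suc i # q" "c' = p @ i # q" using eA_splits[OF assms(2)] by blast
  then show ?thesis using column_distinct[OF assms(1)] by auto
qed

lemma vee_star_eA:
  assumes c: "c \<in> columns n k" and i: "1 \<le> i" "i < 2 * n" and e: "eA i c = Some c'"
  shows "c' \<in> columns n k" and "eA (2 * n - i) (column_vee_star n c) = Some (column_vee_star n c')"
proof -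
  let ?v = "column_vee_star n c" and ?j = "2 * n - i"
  note col = columnsD[OF c]
  obtain p q where "c = p @ Suc i # q" "c' = p @ i # q" "column c'"
    and mem: "Suc i \<in> set c" "i \<notin> set c"
    using column_eA[OF col(1) e] by blast
  then show c': "c' \<in> columns n k" using col i by (auto simp: columns_def)
  have "eps ?j ?v \<noteq> 0" using vee_star_phi_eps(2)[OF c i] eA_None_iff[of i c] e by auto
  then obtain d where d: "eA ?j ?v = Some d" using eA_None_iff[of ?j ?v] by auto
  have v: "column ?v" using columnsD(1) column_vee_star_columns c by blast
  have "set d = set (column_vee_star n c')"
  proof (rule set_eqI)
    fix x
    show "x \<in> set d \<longleftrightarrow> x \<in> set (column_vee_star n c')"
      using i mem unfolding column_eA_set[OF v d] set_vee_star insert_iff Diff_iff column_eA_set[OF col(1) e]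
      by auto
  qed
  moreover have "column d" using column_eA[OF v d] by blast
  moreover have "column (column_vee_star n c')" using columnsD(1) column_vee_star_columns c' by blast
  ultimately show "eA ?j ?v = Some (column_vee_star n c')" using d column_eqI by blast
qed

abbreviation vee_word :: "nat \<Rightarrow> word \<Rightarrow> word \<Rightarrow> word" where
  "vee_word n u v \<equiv> column_vee_star n u @ column_vee_star n v"

definition column_tableau :: "nat \<Rightarrow> nat \<Rightarrow> word \<Rightarrow> word \<Rightarrow> bool" where
  "column_tableau n r u v \<longleftrightarrow> u \<in> columns n (2 * n - r) \<and> v \<in> columns n r \<and> semistandard [u, v]"

lemma semistandard_pair_shape:
  assumes "semistandard T" and "map length T = [k, l]"
  obtains u v where "T = [u, v]" and "length u = k" and "length v = l"
  using assms(2) that by auto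

lemma column_tableau_eA:
  assumes T: "column_tableau n r u v" and i: "1 \<le> i" "i < 2 * n" and e: "eA i (u @ v) = Some w"
  shows "\<exists>u' v'. w = u' @ v' \<and> column_tableau n r u' v' \<and>
    eA (2 * n - i) (vee_word n u v) = Some (vee_word n u' v')"
proof -
  have u: "u \<in> columns n (2 * n - r)" and v: "v \<in> columns n r" and ss: "semistandard [u, v]"
    using T by (auto simp: column_tableau_def)
  have "\<exists>u' v'. w = u' @ v' \<and> u' \<in> columns n (2 * n - r) \<and> v' \<in> columns n r \<and>
    eA (2 * n - i) (vee_word n u v) = Some (vee_word n u' v')"
  proof (cases "eps i u > phi i v")
    case True
    then obtain u' where u': "eA i u = Some u'" "w = u' @ v" using e by (auto simp: eA_append)
    show ?thesis
      using True u' v vee_star_eA[OF u i u'(1)] vee_star_phi_eps[OF u i] vee_star_phi_eps[OF v i]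
      by (intro exI[of _ u'] exI[of _ v]) (simp add: eA_append)
  next
    case False
    then obtain v' where v': "eA i v = Some v'" "w = u @ v'" using e by (auto simp: eA_append)
    show ?thesis
      using False v' u vee_star_eA[OF v i v'(1)] vee_star_phi_eps[OF u i] vee_star_phi_eps[OF v i]
      by (intro exI[of _ u] exI[of _ v']) (simp add: eA_append)
  qed
  then obtain u' v' where uv': "w = u' @ v'" "u' \<in> columns n (2 * n - r)" "v' \<in> columns n r"
    "eA (2 * n - i) (vee_word n u v) = Some (vee_word n u' v')" by blast
  obtain T' where T': "semistandard T'" "map length T' = [length u, length v]" "concat T' = w"
    using eA_semistandard[OF ss, of i w] e by auto
  then obtain x y where "T' = [x, y]" "length x = length u" "length y = length v"
    using semistandard_pair_shape by blast
  then have "T' = [u', v']" using T'(3) uv' u columnsD(2) by auto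
  then show ?thesis using T'(1) uv' unfolding column_tableau_def by blast
qed

text \<open>
  Lowering is the inverse of raising, so \<open>column_tableau_eA\<close> applied to the lowered tableau gives
  the claim.
\<close>

lemma column_tableau_fA:
  assumes T: "column_tableau n r u v" and i: "1 \<le> i" "i < 2 * n" and f: "fA i (u @ v) = Some w"
  shows "\<exists>u' v'. w = u' @ v' \<and> column_tableau n r u' v' \<and>
    fA (2 * n - i) (vee_word n u v) = Some (vee_word n u' v')"
proof -
  have u: "u \<in> columns n (2 * n - r)" and v: "v \<in> columns n r" and ss: "semistandard [u, v]"
    using T by (auto simp: column_tableau_def)
  obtain T' where T': "semistandard T'" "map length T' = [length u, length v]" "concat T' = w"
    using fA_semistandard[OF ss, of i w] f by auto
  then obtain x y where xy: "T' = [x, y]" "length x = length u" "length y = length v"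
    using semistandard_pair_shape by blast
  have "set w \<subseteq> {1..2 * n}"
    using fA_splits[OF f] i columnsD(3)[OF u] columnsD(3)[OF v]
    by (metis Suc_leI atLeastAtMost_iff insert_subset le_SucI list.simps(15) set_append sup.bounded_iff)
  then have ct: "column_tableau n r x y"
    using T' xy columnsD(2)[OF u] columnsD(2)[OF v]
    by (auto simp: column_tableau_def columns_def semistandard_iff)
  have w: "w = x @ y" using T' xy by simp
  then have "eA i (x @ y) = Some (u @ v)" using eA_fA[OF f] by simp
  from column_tableau_eA[OF ct i this] obtain u' v' where
    uv': "u @ v = u' @ v'" "column_tableau n r u' v'"
    "eA (2 * n - i) (vee_word n x y) = Some (vee_word n u' v')" by blast
  then have "u = u'" "v = v'" using columnsD(2) u by (auto simp: column_tableau_def)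
  then have "fA (2 * n - i) (vee_word n u v) = Some (vee_word n x y)" using fA_eA uv'(3) by blast
  then show ?thesis using w ct by blast
qed

definition self_dual_tableau :: "nat \<Rightarrow> nat \<Rightarrow> word \<Rightarrow> word \<Rightarrow> bool" where
  "self_dual_tableau n r u v \<longleftrightarrow> column_tableau n r u v \<and> u @ v \<sim> vee_word n u v"

text \<open>
  Stated for a family \<open>g\<close> of operators so as to cover raising and lowering at once. For \<open>i < n\<close> the
  involution turns \<open>g\<^sub>i\<close> followed by \<open>g\<^sub>j\<close>, where \<open>j = 2n - i\<close>, into \<open>g\<^sub>j\<close> followed by \<open>g\<^sub>i\<close>. The order does not
  matter, because \<open>j\<close> differs from \<open>i\<close> by at least two.
\<close>

lemma self_dual_virtual_step:
  fixes g :: "nat \<Rightarrow> word \<Rightarrow> word option"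
  assumes step: "\<And>i u v w. column_tableau n r u v \<Longrightarrow> 1 \<le> i \<Longrightarrow> i < 2 * n \<Longrightarrow> g i (u @ v) = Some w \<Longrightarrow>
      \<exists>u' v'. w = u' @ v' \<and> column_tableau n r u' v' \<and> g (2 * n - i) (vee_word n u v) = Some (vee_word n u' v')"
    and swap: "\<And>i j w w1 w2. Suc i < j \<or> Suc j < i \<Longrightarrow> g i w = Some w1 \<Longrightarrow> g j w1 = Some w2 \<Longrightarrow>
      \<exists>w'. g j w = Some w' \<and> g i w' = Some w2"
    and equiv: "\<And>i w w'. w \<sim> w' \<Longrightarrow> rel_option knuth_equiv (g i w) (g i w')"
    and b: "self_dual_tableau n r u v" and i: "1 \<le> i" "i \<le> n"
    and w: "(if i = n then g n (u @ v) else Option.bind (g i (u @ v)) (g (2 * n - i))) = Some w"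
  shows "\<exists>u' v'. w = u' @ v' \<and> self_dual_tableau n r u' v'"
proof (cases "i = n")
  case True
  then have n: "1 \<le> n" "n < 2 * n" "2 * n - n = n" and g: "g n (u @ v) = Some w" using i w by auto
  obtain u' v' where uv': "w = u' @ v'" "column_tableau n r u' v'" "g n (vee_word n u v) = Some (vee_word n u' v')"
    using step[OF _ n(1,2) g] b n(3) unfolding self_dual_tableau_def by auto
  have "rel_option knuth_equiv (g n (u @ v)) (g n (vee_word n u v))"
    using b equiv unfolding self_dual_tableau_def by blast
  then show ?thesis using g uv' unfolding self_dual_tableau_def by auto
next
  case False
  let ?j = "2 * n - i"
  have ij: "i < 2 * n" "1 \<le> ?j" "?j < 2 * n" "2 * n - ?j = i" "Suc i < ?j" using i False by auto
  obtain w1 where g: "g i (u @ v) = Some w1" "g ?j w1 = Some w"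
    using w False by (auto simp: bind_eq_Some_conv)
  obtain u1 v1 where uv1: "w1 = u1 @ v1" "column_tableau n r u1 v1" "g ?j (vee_word n u v) = Some (vee_word n u1 v1)"
    using step[OF _ i(1) ij(1) g(1)] b unfolding self_dual_tableau_def by auto
  obtain u2 v2 where uv2: "w = u2 @ v2" "column_tableau n r u2 v2" "g i (vee_word n u1 v1) = Some (vee_word n u2 v2)"
    using step[OF uv1(2) ij(2,3), of w] g(2) uv1(1) ij(4) by auto
  obtain w1' where g': "g ?j (u @ v) = Some w1'" "g i w1' = Some w"
    using swap[of i ?j, OF _ g] ij(5) by blast
  have "rel_option knuth_equiv (g ?j (u @ v)) (g ?j (vee_word n u v))"
    using b equiv unfolding self_dual_tableau_def by blast
  then have "w1' \<sim> vee_word n u1 v1" using g'(1) uv1(3) by simp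
  then have "rel_option knuth_equiv (g i w1') (g i (vee_word n u1 v1))" by (rule equiv)
  then have "w \<sim> vee_word n u2 v2" using g'(2) uv2(3) by simp
  then show ?thesis using uv2 unfolding self_dual_tableau_def by blast
qed

lemma self_dual_virtual_e:
  assumes "self_dual_tableau n r u v" and "1 \<le> i" "i \<le> n" and "virtual_e n i (u @ v) = Some w"
  shows "\<exists>u' v'. w = u' @ v' \<and> self_dual_tableau n r u' v'"
  by (rule self_dual_virtual_step[OF column_tableau_eA eA_swap knuth_equiv_eA assms(1-3)
        assms(4)[unfolded virtual_e_def]])

lemma self_dual_virtual_f:
  assumes "self_dual_tableau n r u v" and "1 \<le> i" "i \<le> n" and "virtual_f n i (u @ v) = Some w"
  shows "\<exists>u' v'. w = u' @ v' \<and> self_dual_tableau n r u' v'"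
  by (rule self_dual_virtual_step[OF column_tableau_fA fA_swap knuth_equiv_fA assms(1-3)
        assms(4)[unfolded virtual_f_def]])

text \<open>
  The involution exchanges the two columns of the generator.
\<close>

lemma self_dual_generator:
  assumes "r \<le> n" and "1 \<le> r"
  shows "self_dual_tableau n r (rev [1..<2 * n - r + 1]) (rev [1..<r + 1])"
proof -
  let ?u = "rev [1..<2 * n - r + 1]" and ?v = "rev [1..<r + 1]"
  have u: "?u \<in> columns n (2 * n - r)" and v: "?v \<in> columns n r"
    using assms by (auto simp: columns_def sorted_wrt_rev simp del: upt_Suc)
  have sub: "set ?v \<subseteq> set ?u" using assms by auto
  then have "dominates ?u ?v"
    using dominates_if_subset columnsD(1)[OF u] columnsD(1)[OF v] by blast
  then have "semistandard [?u, ?v]"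
    using columnsD[OF u] columnsD[OF v] assms by (auto simp: semistandard_iff)
  moreover have "set (column_vee_star n ?u) = set ?v" "set (column_vee_star n ?v) = set ?u"
    using assms by (auto simp: set_vee_star)
  then have "column_vee_star n ?u = ?v" "column_vee_star n ?v = ?u"
    using column_eqI column_vee_star_columns columnsD(1) u v by metis+
  moreover have "?u @ ?v \<sim> ?v @ ?u"
    by (rule knuth_equiv_sym[OF column_commutes_word[OF columnsD(1)[OF u] sub]])
  ultimately show ?thesis using u v by (simp add: self_dual_tableau_def column_tableau_def)
qed

lemma eps_pos_mem: "0 < eps i w \<Longrightarrow> Suc i \<in> set w"
  by (induction w) (auto simp: letter_defs split: if_splits)

text \<open>
  Self-duality makes \<open>\<epsilon>\<close> symmetric under \<open>i \<mapsto> 2n - i\<close>. For \<open>i < n\<close>, applying \<open>e\<^sub>i\<close> does not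
  change \<open>\<epsilon>\<close> at \<open>2n - i\<close>, so if \<open>\<epsilon>\<^sub>i\<close> were positive then the virtual \<open>e\<^sub>i\<close> would apply.
\<close>

lemma virtual_highest_weight:
  assumes b: "self_dual_tableau n r u v" and none: "\<And>i. 1 \<le> i \<Longrightarrow> i \<le> n \<Longrightarrow> virtual_e n i (u @ v) = None"
  shows "highest_weight (u @ v)"
  unfolding highest_weight_def
proof (intro allI impI)
  have u: "u \<in> columns n (2 * n - r)" and v: "v \<in> columns n r" and eq: "u @ v \<sim> vee_word n u v"
    using b by (auto simp: self_dual_tableau_def column_tableau_def)
  have sym: "eps (2 * n - i) (u @ v) = eps i (u @ v)" if "1 \<le> i" "i < 2 * n" for i
    using knuth_equiv_eps[OF eq, of "2 * n - i"] vee_star_phi_eps[OF u that] vee_star_phi_eps[OF v that]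
    by (simp add: eps_append)
  have low: "eps i (u @ v) = 0" if i: "1 \<le> i" "i < n" for i
  proof (rule ccontr)
    assume pos: "eps i (u @ v) \<noteq> 0"
    then obtain w1 where w1: "eA i (u @ v) = Some w1" using eA_None_iff[of i "u @ v"] by auto
    have "Suc i < 2 * n - i" using i by auto
    then have "eps (2 * n - i) w1 = eps (2 * n - i) (u @ v)"
      using eA_splits[OF w1] far_phi_eps(2)[of i "2 * n - i"] by auto
    then have "eps (2 * n - i) w1 \<noteq> 0" using sym[of i] pos i by simp
    then have "eA (2 * n - i) w1 \<noteq> None" by (simp add: eA_None_iff)
    then show False using none[of i] i w1 by (simp add: virtual_e_def)
  qed
  fix i :: nat assume "1 \<le> i"
  consider "i < n" | "i = n" | "n < i" "i < 2 * n" | "2 * n \<le> i" by linarith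
  then show "eps i (u @ v) = 0"
  proof cases
    case 1
    then show ?thesis using low \<open>1 \<le> i\<close> by blast
  next
    case 2
    then show ?thesis using none[of n] \<open>1 \<le> i\<close> by (simp add: virtual_e_def eA_None_iff)
  next
    case 3
    then show ?thesis using low[of "2 * n - i"] sym[OF \<open>1 \<le> i\<close> 3(2)] by auto
  next
    case 4
    then have "Suc i \<notin> set (u @ v)" using columnsD(3)[OF u] columnsD(3)[OF v] by auto
    then show ?thesis using eps_pos_mem by blast
  qed
qed

lemma virtual_f_virtual_e:
  assumes "i \<le> n" and e: "virtual_e n i w = Some w'"
  shows "virtual_f n i w' = Some w"
proof (cases "i = n")
  case True
  then show ?thesis using e fA_eA by (simp add: virtual_e_def virtual_f_def)
next
  case False
  then obtain w1 where "eA i w = Some w1" "eA (2 * n - i) w1 = Some w'"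
    using e by (auto simp: virtual_e_def bind_eq_Some_conv)
  then have "fA (2 * n - i) w' = Some w1" "fA i w1 = Some w" by (auto intro: fA_eA)
  moreover have "Suc i < 2 * n - i" using False assms(1) by auto
  ultimately obtain w2 where "fA i w' = Some w2" "fA (2 * n - i) w2 = Some w"
    using fA_swap by blast
  then show ?thesis using False by (simp add: virtual_f_def)
qed

lemma virtual_e_sum_list:
  assumes "virtual_e n i w = Some w'"
  shows "sum_list w' < sum_list w"
proof -
  have "sum_list y < sum_list x" if "eA k x = Some y" for k x y
    using eA_splits[OF that] by auto
  then show ?thesis
    using assms by (auto simp: virtual_e_def bind_eq_Some_conv split: if_splits intro: less_trans)
qed

lemma V_imp_self_dual:
  assumes "1 \<le> r" and "r \<le> n" and "b \<in> V n r"
  shows "self_dual_tableau n r (fst b) (snd b)"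
  using assms(3)
proof (induction rule: V.induct)
  case generator
  then show ?case using self_dual_generator assms by simp
next
  have split: "self_dual_tableau n r (fst b') (snd b')"
    if b: "self_dual_tableau n r (fst b) (snd b)" and b': "on_pair g b = Some b'"
      and step: "\<And>w. g (fst b @ snd b) = Some w \<Longrightarrow> \<exists>u' v'. w = u' @ v' \<and> self_dual_tableau n r u' v'" for g b b'
  proof -
    obtain w where w: "g (fst b @ snd b) = Some w"
      "b' = (take (length (fst b)) w, drop (length (fst b)) w)"
      using b' by (auto simp: on_pair_def)
    obtain u' v' where uv': "w = u' @ v'" "self_dual_tableau n r u' v'" using step w(1) by blast
    have "length u' = length (fst b)"
      using uv'(2) b columnsD(2) by (metis self_dual_tableau_def column_tableau_def)
    then show ?thesis using w(2) uv' by simp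
  qed
  {
    case (e_closed b i b')
    then show ?case using split self_dual_virtual_e by blast
  next
    case (f_closed b i b')
    then show ?case using split self_dual_virtual_f by blast
  }
qed

lemma self_dual_imp_V:
  assumes "1 \<le> n" and "1 \<le> r" and "r \<le> n" and "self_dual_tableau n r u v"
  shows "(u, v) \<in> V n r"
  using assms(4)
proof (induction "sum_list (u @ v)" arbitrary: u v rule: less_induct)
  case less
  have u: "u \<in> columns n (2 * n - r)" and v: "v \<in> columns n r" and ss: "semistandard [u, v]"
    using less.prems by (auto simp: self_dual_tableau_def column_tableau_def)
  show ?case
  proof (cases "\<exists>i w. 1 \<le> i \<and> i \<le> n \<and> virtual_e n i (u @ v) = Some w")
    case True
    then obtain i w where i: "1 \<le> i" "i \<le> n" and e: "virtual_e n i (u @ v) = Some w" by blast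
    obtain u' v' where uv': "w = u' @ v'" "self_dual_tableau n r u' v'"
      using self_dual_virtual_e[OF less.prems i e] by blast
    then have "(u', v') \<in> V n r" using less.hyps virtual_e_sum_list[OF e] by blast
    moreover have "length u' = length u"
      using uv'(2) columnsD(2) u by (metis self_dual_tableau_def column_tableau_def)
    then have "on_pair (virtual_f n i) (u', v') = Some (u, v)"
      using virtual_f_virtual_e[OF i(2) e] uv'(1) by (simp add: on_pair_def)
    ultimately show ?thesis using i V.f_closed by blast
  next
    case False
    then have "highest_weight (u @ v)"
      using virtual_highest_weight[OF less.prems] by (metis option.exhaust)
    then have "\<forall>c\<in>set [u, v]. c = rev [1..<length c + 1]"
      using columnsD(4)[OF u] columnsD(4)[OF v] by (intro highest_tableau[OF ss]) auto
    then have "u = rev [1..<2 * n - r + 1]" "v = rev [1..<r + 1]"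
      using columnsD(2)[OF u] columnsD(2)[OF v] by (metis list.set_intros)+
    then show ?thesis using V.generator by metis
  qed
qed

theorem proposition6p26:
  fixes n r :: nat and b :: "word \<times> word"
  assumes "1 \<le> n" and "1 \<le> r" and "r \<le> n"
  shows "b \<in> V n r \<longleftrightarrow> b \<in> Vhat n r \<and> is_tableau b \<and> vee_star n b = local_iso n r b"
proof -
  obtain u v where b: "b = (u, v)" by (cases b)
  have "b \<in> V n r \<longleftrightarrow> self_dual_tableau n r u v"
    using V_imp_self_dual[OF assms(2,3)] self_dual_imp_V[OF assms] b by fastforce
  also have "\<dots> \<longleftrightarrow> b \<in> Vhat n r \<and> is_tableau b \<and> u @ v \<sim> vee_word n u v"
    by (auto simp: self_dual_tableau_def column_tableau_def Vhat_def is_tableau_def b)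
  also have "\<dots> \<longleftrightarrow> b \<in> Vhat n r \<and> is_tableau b \<and> vee_star n b = local_iso n r b"
  proof -
    have "vee_star n b = local_iso n r b \<longleftrightarrow> u @ v \<sim> vee_word n u v"
      if "b \<in> Vhat n r" and "is_tableau b"
    proof -
      have u: "u \<in> columns n (2 * n - r)" and v: "v \<in> columns n r" and ss: "semistandard [u, v]"
        using that by (auto simp: Vhat_def is_tableau_def b)
      have "2 * n - (2 * n - r) = r" using assms by simp
      then have "column_vee_star n u \<in> columns n r" "column_vee_star n v \<in> columns n (2 * n - r)"
        using column_vee_star_columns[OF u] column_vee_star_columns[OF v] by simp_all
      from local_iso_eq_iff[OF u v ss this] show ?thesis by (auto simp: vee_star_def b)
    qed
    then show ?thesis by blast
  qed
  finally show ?thesis .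
qed

end
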